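(* Let $X$ be a Banach space and consider the initial value problem $u'(t)=F(u(t))$, $u(t_0)=u_0$. Suppose that it possesses a sufficiently smooth solution $u:[0,T]\to X$ with derivatives in $X$, that $F:X\to X$ is sufficiently often Fréchet differentiable in a strip along the exact solution, and that all occurring derivatives are bounded. Consider for its numerical solution an explicit 2-stage exponential Rosenbrock scheme (as defined in the context) with node $c_2=\frac34$ and coefficient $b_2$ satisfying $$b_2(hJ_n)=\frac{16}{27}I+\frac{4}{27}hJ_n+\mathcal{O}(h^2).$$ Then the method converges with order four, i.e. $$\|u_n-u(t_n)\|\le C h^4$$ on $t_0\le t_n=t_0+nh\le T$, with a constant $C$ that is independent of $n$ and $h$.
   Context: Functions $\varphi_k$: $\varphi_0(z)=e^z$ and $\varphi_k(z)=\int_0^1 e^{(1-\theta)z}\frac{\theta^{k-1}}{(k-1)!}\,d\theta$ for $k\ge1$; they are entire and are applied to operators. Explicit 2-stage exponential Rosenbrock scheme with node $c_2$ and coefficient $b_2$, constant step size $h>0$, $t_n=t_0+nh$, starting from the initial value $u_0$, with $u_n\approx u(t_n)$: with $J_n=\frac{\partial F}{\partial u}(u_n)$ and $g_n(u)=F(u)-J_nu$, $$U_{n2}=u_n+c_2h\varphi_1(c_2hJ_n)F(u_n),\qquad u_{n+1}=u_n+h\varphi_1(hJ_n)F(u_n)+h\,b_2(hJ_n)\big(g_n(U_{n2})-g_n(u_n)\big).$$ The coefficient $b_2$ is a function given by a power series, $b_2(hJ)=\sum_{k\ge0}\beta_k(hJ)^k$ (typically a linear combination of the $\varphi_k$), so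 the condition on $b_2$ in the claim says $\beta_0=\frac{16}{27}$, $\beta_1=\frac4{27}$.
   Formalization: The error bound is proved for all sufficiently small step sizes 0 < h ≤ h0, with h0 and C independent of n and h; for large h the stage may leave the strip, where F is uncontrolled, or the power series of b_2 may diverge, and the bound can fail. *)

theory Defs
  imports "HOL-Analysis.Analysis"
begin

section \<open>Functions of bounded operators\<close>

text \<open>The type of bounded operators on a Banach space is not an instance of the library's
  Banach algebra classes, so \<^const>\<open>exp\<close> and powers are not available on it.\<close>

definition op_power :: "('a::banach \<Rightarrow>\<^sub>L 'a) \<Rightarrow> nat \<Rightarrow> ('a \<Rightarrow>\<^sub>L 'a)" where
  "op_power A k = (blinfun_compose A ^^ k) id_blinfun"

definition op_series :: "(nat \<Rightarrow> real) \<Rightarrow> ('a::banach \<Rightarrow>\<^sub>L 'a) \<Rightarrow> ('a \<Rightarrow>\<^sub>L 'a)" where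
  "op_series \<beta> A = (\<Sum>k. \<beta> k *\<^sub>R op_power A k)"

definition op_exp :: "('a::banach \<Rightarrow>\<^sub>L 'a) \<Rightarrow> ('a \<Rightarrow>\<^sub>L 'a)" where
  "op_exp = op_series (\<lambda>k. 1 / fact k)"

definition phi :: "nat \<Rightarrow> ('a::banach \<Rightarrow>\<^sub>L 'a) \<Rightarrow> ('a \<Rightarrow>\<^sub>L 'a)" where
  "phi k A =
     (if k = 0 then op_exp A
      else integral {0..1}
             (\<lambda>\<theta>. (\<theta> ^ (k - 1) / fact (k - 1)) *\<^sub>R op_exp ((1 - \<theta>) *\<^sub>R A)))"


section \<open>Smoothness\<close>

text \<open>The Frechet derivative as a bounded operator. Since its values lie again in a normed space
  (with the operator norm), it can be iterated: \<open>fderiv (fderiv F)\<close> is the second derivative,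
  with values in \<open>'a \<Rightarrow>\<^sub>L 'a \<Rightarrow>\<^sub>L 'a\<close>, and so on. It is meaningful only at points of
  differentiability.\<close>

definition fderiv ::
  "('a::real_normed_vector \<Rightarrow> 'b::real_normed_vector) \<Rightarrow> 'a \<Rightarrow> ('a \<Rightarrow>\<^sub>L 'b)" where
  "fderiv f x = Blinfun (frechet_derivative f (at x))"

definition differentiable_bounded_on ::
  "('a::real_normed_vector \<Rightarrow> 'b::real_normed_vector) \<Rightarrow> 'a set \<Rightarrow> bool" where
  "differentiable_bounded_on f S \<longleftrightarrow>
     (\<forall>x\<in>S. f differentiable (at x)) \<and> bounded (fderiv f ` S)"

text \<open>Four times Frechet differentiable with bounded derivatives. The orders are listed one by one
  because the iterated derivatives have different types.\<close>

definition four_times_differentiable_bounded_on ::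
  "('a::real_normed_vector \<Rightarrow> 'b::real_normed_vector) \<Rightarrow> 'a set \<Rightarrow> bool" where
  "four_times_differentiable_bounded_on f S \<longleftrightarrow>
     differentiable_bounded_on f S \<and>
     differentiable_bounded_on (fderiv f) S \<and>
     differentiable_bounded_on (fderiv (fderiv f)) S \<and>
     differentiable_bounded_on (fderiv (fderiv (fderiv f))) S"

text \<open>A curve that is \<open>m\<close> times differentiable on \<open>I\<close> (one-sided at endpoints of an interval) with
  bounded derivatives; \<open>d i\<close> is the \<open>i\<close>-th derivative.\<close>

definition curve_differentiable_bounded_on ::
  "nat \<Rightarrow> (real \<Rightarrow> 'a::real_normed_vector) \<Rightarrow> real set \<Rightarrow> bool" where
  "curve_differentiable_bounded_on m u I \<longleftrightarrow>
     (\<exists>d :: nat \<Rightarrow> real \<Rightarrow> 'a.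
        (\<forall>t\<in>I. d 0 t = u t) \<and>
        (\<forall>i<m. \<forall>t\<in>I. (d i has_vector_derivative d (Suc i) t) (at t within I)) \<and>
        (\<forall>i\<le>m. bounded (d i ` I)))"

definition strip :: "(real \<Rightarrow> 'a::real_normed_vector) \<Rightarrow> real set \<Rightarrow> real \<Rightarrow> 'a set" where
  "strip u I R = {v. \<exists>t\<in>I. norm (v - u t) < R}"


section \<open>Explicit 2-stage exponential Rosenbrock schemes\<close>

text \<open>\<open>rb_remainder F v\<close> is the nonlinear part $g_n$ of the linearization at $v = u_n$; the
  coefficient $b_2$ is given by its power series coefficients \<open>\<beta>\<close>.\<close>

definition rb_remainder :: "('a::banach \<Rightarrow> 'a) \<Rightarrow> 'a \<Rightarrow> 'a \<Rightarrow> 'a" where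
  "rb_remainder F v w = F w - fderiv F v w"

definition exprb2_stage :: "real \<Rightarrow> ('a::banach \<Rightarrow> 'a) \<Rightarrow> real \<Rightarrow> 'a \<Rightarrow> 'a" where
  "exprb2_stage c2 F h v = v + (c2 * h) *\<^sub>R phi 1 ((c2 * h) *\<^sub>R fderiv F v) (F v)"

definition exprb2_step ::
  "real \<Rightarrow> (nat \<Rightarrow> real) \<Rightarrow> ('a::banach \<Rightarrow> 'a) \<Rightarrow> real \<Rightarrow> 'a \<Rightarrow> 'a" where
  "exprb2_step c2 \<beta> F h v =
     v + h *\<^sub>R phi 1 (h *\<^sub>R fderiv F v) (F v)
       + h *\<^sub>R op_series \<beta> (h *\<^sub>R fderiv F v)
            (rb_remainder F v (exprb2_stage c2 F h v) - rb_remainder F v v)"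

primrec exprb2 ::
  "real \<Rightarrow> (nat \<Rightarrow> real) \<Rightarrow> ('a::banach \<Rightarrow> 'a) \<Rightarrow> real \<Rightarrow> 'a \<Rightarrow> nat \<Rightarrow> 'a" where
  "exprb2 c2 \<beta> F h u0 0 = u0"
| "exprb2 c2 \<beta> F h u0 (Suc n) = exprb2_step c2 \<beta> F h (exprb2 c2 \<beta> F h u0 n)"

end

theory Submission
  imports Defs
begin

text \<open>
  Convergence is consistency plus stability. The local error of one step, started at a point
  \<open>v\<close> of the solution curve, is \<open>O(h\<^sup>5)\<close>, and a step increases the distance between
  a nearby point and \<open>v\<close> at most by a factor \<open>1 + O(h)\<close>, so over the \<open>O(1/h)\<close> steps of a bounded time interval the errors
  add up to \<open>O(h\<^sup>4)\<close>.

  Write \<open>f = F v\<close>, \<open>J\<close>, \<open>B\<close>, \<open>Q\<close> for the first three derivatives of \<open>F\<close> at \<open>v\<close>, and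
  \<open>r(w) = F(v + w) - F v - J w\<close> for the nonlinear remainder. The point is that the exact increment
  \<open>w(s) = u(t + s) - u t\<close> and the increment of the stage \<open>U\<^sub>2\<close> with node \<open>c\<close>, where
  \<open>s = c h\<close>, have the same expansion \<open>s f + s\<^sup>2/2 J f + O(s\<^sup>3)\<close>. Hence both
  see the same remainder \<open>r = s\<^sup>2 a + s\<^sup>3 b + O(s\<^sup>4)\<close> (lemma \<open>remainder_expansion\<close>), where
  \<open>a = B(f,f)/2\<close> and \<open>b\<close> collects the third-order terms. The differential equation
  \<open>w' = f + J w + r(w)\<close> then forces
  \<open>w(h) = (h + h\<^sup>2/2 J + h\<^sup>3/6 J\<^sup>2 + h\<^sup>4/24 J\<^sup>3) f + h\<^sup>3/3 a + h\<^sup>4/12 J a + h\<^sup>4/4 b + O(h\<^sup>5)\<close>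
  (lemma \<open>exact_expansion\<close>). The scheme produces the linear part through \<open>\<phi>\<^sub>1\<close>, and for the rest
  \<open>h (\<beta>\<^sub>0 + \<beta>\<^sub>1 h J + O(h\<^sup>2)) (c\<^sup>2 h\<^sup>2 a + c\<^sup>3 h\<^sup>3 b + O(h\<^sup>4))\<close>. Matching requires
  \<open>\<beta>\<^sub>0 c\<^sup>2 = 1/3\<close>, \<open>\<beta>\<^sub>0 c\<^sup>3 = 1/4\<close> and \<open>\<beta>\<^sub>1 c\<^sup>2 = 1/12\<close>, whose unique solution is
  \<open>c = 3/4\<close>, \<open>\<beta>\<^sub>0 = 16/27\<close>, \<open>\<beta>\<^sub>1 = 4/27\<close> (lemma \<open>local_error\<close>).

  The expansion of \<open>w\<close> is obtained by inserting the current one into the differential equation and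
  integrating with the mean value inequality; each pass gains a power of \<open>h\<close>. All constants have
  to be uniform in \<open>t\<close> and \<open>h\<close>, which is organised by a relation \<open>dominated\<close> on families indexed by
  an arbitrary set. Stability (lemma \<open>step_increment_lipschitz\<close>) uses the same relation on families
  indexed by step size, time and perturbed point.
\<close>

section \<open>Power series of a bounded operator\<close>

lemma op_power_0 [simp]: "op_power A 0 = id_blinfun"
  by (simp add: op_power_def)

lemma op_power_Suc: "op_power A (Suc k) = A o\<^sub>L op_power A k"
  by (simp add: op_power_def)

lemma op_power_scaleR: "op_power (c *\<^sub>R A) k = c ^ k *\<^sub>R op_power A k"
  by (induction k)
     (auto simp: op_power_Suc blinfun.bilinear_simps intro!: blinfun_eqI)

lemma norm_op_power_le: "norm (op_power A k) \<le> norm A ^ k"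
proof (induction k)
  case 0
  then show ?case by (simp add: norm_blinfun_id_le)
next
  case (Suc k)
  have "norm (op_power A (Suc k)) \<le> norm A * norm (op_power A k)"
    unfolding op_power_Suc by (rule norm_blinfun_compose)
  also have "\<dots> \<le> norm A * norm A ^ k"
    using Suc by (intro mult_left_mono) auto
  finally show ?case by simp
qed

text \<open>Telescoping: \<open>A\<^sup>k\<^sup>+\<^sup>1 - B\<^sup>k\<^sup>+\<^sup>1 = A (A\<^sup>k - B\<^sup>k) + (A - B) B\<^sup>k\<close>.\<close>

lemma norm_op_power_diff_le:
  assumes "norm A \<le> r" "norm B \<le> r"
  shows "norm (op_power A k - op_power B k) \<le> real k * r ^ (k - 1) * norm (A - B)"
proof (induction k)
  case 0
  then show ?case by simp
next
  case (Suc k)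
  have r: "0 \<le> r" using assms(1) norm_ge_zero order_trans by blast
  have split: "op_power A (Suc k) - op_power B (Suc k)
      = (A o\<^sub>L (op_power A k - op_power B k)) + ((A - B) o\<^sub>L op_power B k)"
    by (auto simp: op_power_Suc blinfun.bilinear_simps intro!: blinfun_eqI)
  have "norm (A o\<^sub>L (op_power A k - op_power B k))
      \<le> r * (real k * r ^ (k - 1) * norm (A - B))"
    by (rule order_trans[OF norm_blinfun_compose]) (intro mult_mono assms Suc r norm_ge_zero)
  also have "\<dots> = real k * r ^ k * norm (A - B)"
    by (cases k) auto
  finally have 1: "norm (A o\<^sub>L (op_power A k - op_power B k)) \<le> real k * r ^ k * norm (A - B)" .
  have "norm (op_power B k) \<le> r ^ k"
    by (rule order_trans[OF norm_op_power_le]) (intro power_mono assms norm_ge_zero)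
  then have "norm ((A - B) o\<^sub>L op_power B k) \<le> norm (A - B) * r ^ k"
    by (intro order_trans[OF norm_blinfun_compose] mult_left_mono) auto
  then show ?case
    using 1 norm_triangle_ineq[of "A o\<^sub>L (op_power A k - op_power B k)" "(A - B) o\<^sub>L op_power B k"]
    unfolding split by (simp add: algebra_simps)
qed

lemma op_series_term_le:
  assumes "norm A \<le> r"
  shows "norm (\<beta> k *\<^sub>R op_power A k) \<le> \<bar>\<beta> k\<bar> * r ^ k"
  using order_trans[OF norm_op_power_le power_mono[OF assms norm_ge_zero], of k]
  by (simp add: mult_left_mono)

lemma op_series_sums:
  assumes "summable (\<lambda>k. \<bar>\<beta> k\<bar> * r ^ k)" "norm A \<le> r"
  shows "(\<lambda>k. \<beta> k *\<^sub>R op_power A k) sums op_series \<beta> A"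
  unfolding op_series_def
  by (rule summable_sums, rule summable_comparison_test'[OF assms(1), where N = 0])
     (rule op_series_term_le[OF assms(2)])

text \<open>The tail of the series starts with \<open>A\<^sup>m\<close>. Here and below the hypothesis on \<open>r\<close> says that the
  scalar series converges absolutely at \<open>r\<close>; the resulting constant depends on \<open>r\<close> only, hence is
  uniform over the ball of that radius. The case \<open>m = 0\<close> is a bound for the series itself.\<close>

lemma op_series_remainder:
  assumes "summable (\<lambda>k. \<bar>\<beta> k\<bar> * r ^ k)" "r > 0"
  shows "\<exists>C\<ge>0. \<forall>A::'a::banach \<Rightarrow>\<^sub>L 'a. norm A \<le> r \<longrightarrow>
    norm (op_series \<beta> A - (\<Sum>k<m. \<beta> k *\<^sub>R op_power A k)) \<le> C * norm A ^ m"
proof (intro exI[where x = "(\<Sum>k. \<bar>\<beta> (k + m)\<bar> * r ^ k)"] conjI allI impI)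
  have s: "summable (\<lambda>k. \<bar>\<beta> (k + m)\<bar> * r ^ k)"
    using summable_mult2[OF summable_ignore_initial_segment[OF assms(1), of m], of "1 / r ^ m"] assms(2)
    by (simp add: power_add)
  then show "0 \<le> (\<Sum>k. \<bar>\<beta> (k + m)\<bar> * r ^ k)"
    using assms(2) by (intro suminf_nonneg) auto
  fix A :: "'a \<Rightarrow>\<^sub>L 'a" assume A: "norm A \<le> r"
  have bound: "norm (\<beta> (k + m) *\<^sub>R op_power A (k + m)) \<le> norm A ^ m * (\<bar>\<beta> (k + m)\<bar> * r ^ k)" for k
  proof -
    have "norm (op_power A (k + m)) \<le> norm A ^ m * norm A ^ k"
      using norm_op_power_le[of A "k + m"] by (simp add: power_add mult.commute)
    also have "\<dots> \<le> norm A ^ m * r ^ k"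
      by (intro mult_left_mono power_mono A) auto
    finally show ?thesis
      by (simp add: mult_left_mono mult.left_commute[of "norm A ^ m"])
  qed
  note sums = op_series_sums[OF assms(1) A]
  have "op_series \<beta> A - (\<Sum>k<m. \<beta> k *\<^sub>R op_power A k) = (\<Sum>k. \<beta> (k + m) *\<^sub>R op_power A (k + m))"
    using suminf_minus_initial_segment[OF sums_summable[OF sums], of m] sums_unique[OF sums] by simp
  also have "norm \<dots> \<le> (\<Sum>k. norm A ^ m * (\<bar>\<beta> (k + m)\<bar> * r ^ k))"
    by (rule norm_suminf_le[OF bound summable_mult[OF s]])
  also have "\<dots> = (\<Sum>k. \<bar>\<beta> (k + m)\<bar> * r ^ k) * norm A ^ m"
    by (subst suminf_mult[OF s]) (rule mult.commute)
  finally show "norm (op_series \<beta> A - (\<Sum>k<m. \<beta> k *\<^sub>R op_power A k)) \<le> \<dots>" .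
qed

lemma op_series_lipschitz:
  assumes "summable (\<lambda>k. \<bar>\<beta> k\<bar> * r ^ k)" "r > 0"
  shows "\<exists>C\<ge>0. \<forall>A B::'a::banach \<Rightarrow>\<^sub>L 'a. norm A \<le> r / 2 \<longrightarrow> norm B \<le> r / 2 \<longrightarrow>
    norm (op_series \<beta> A - op_series \<beta> B) \<le> C * norm (A - B)"
proof (intro exI[where x = "(\<Sum>k. 2 / r * (\<bar>\<beta> k\<bar> * r ^ k))"] conjI allI impI)
  show "0 \<le> (\<Sum>k. 2 / r * (\<bar>\<beta> k\<bar> * r ^ k))"
    using assms by (intro suminf_nonneg summable_mult) auto
  fix A B :: "'a \<Rightarrow>\<^sub>L 'a" assume AB: "norm A \<le> r / 2" "norm B \<le> r / 2"
  \<comment> \<open>Halving the radius absorbs the factor \<open>k\<close> that differentiating a power produces.\<close>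
  have k: "real k * (r / 2) ^ (k - 1) \<le> 2 / r * r ^ k" for k
  proof (cases k)
    case (Suc j)
    have "real k \<le> 2 ^ k" using of_nat_less_two_power[of k, where 'a = real] by linarith
    then have "r ^ j * real k \<le> r ^ j * 2 ^ k" using assms(2) by (intro mult_left_mono) auto
    then show ?thesis using Suc assms(2) by (simp add: field_simps)
  qed (use assms in auto)
  have bound: "norm (\<beta> k *\<^sub>R op_power A k - \<beta> k *\<^sub>R op_power B k)
      \<le> 2 / r * (\<bar>\<beta> k\<bar> * r ^ k) * norm (A - B)" for k
  proof -
    have "norm (\<beta> k *\<^sub>R op_power A k - \<beta> k *\<^sub>R op_power B k)
        = \<bar>\<beta> k\<bar> * norm (op_power A k - op_power B k)"
      by (simp flip: scaleR_diff_right)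
    also have "\<dots> \<le> \<bar>\<beta> k\<bar> * (real k * (r / 2) ^ (k - 1) * norm (A - B))"
      by (intro mult_left_mono norm_op_power_diff_le AB) auto
    also have "\<dots> \<le> \<bar>\<beta> k\<bar> * (2 / r * r ^ k * norm (A - B))"
      by (intro mult_left_mono mult_right_mono k) auto
    finally show ?thesis by (simp add: mult_ac)
  qed
  have AB': "norm A \<le> r" "norm B \<le> r" using AB assms(2) by auto
  note sums = sums_diff[OF op_series_sums[OF assms(1) AB'(1)] op_series_sums[OF assms(1) AB'(2)]]
  have "op_series \<beta> A - op_series \<beta> B = (\<Sum>k. \<beta> k *\<^sub>R op_power A k - \<beta> k *\<^sub>R op_power B k)"
    using sums_unique[OF sums] .
  also have "norm \<dots> \<le> (\<Sum>k. 2 / r * (\<bar>\<beta> k\<bar> * r ^ k) * norm (A - B))"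
    by (rule norm_suminf_le[OF bound]) (intro summable_mult2 summable_mult assms)
  also have "\<dots> = (\<Sum>k. 2 / r * (\<bar>\<beta> k\<bar> * r ^ k)) * norm (A - B)"
    by (rule suminf_mult2[symmetric]) (intro summable_mult assms)
  finally show "norm (op_series \<beta> A - op_series \<beta> B) \<le> \<dots>" .
qed

text \<open>The Taylor coefficients of \<open>\<phi>\<^sub>1(z) = (e\<^sup>z - 1)/z\<close>.\<close>

definition phi1_coeff :: "nat \<Rightarrow> real" where
  "phi1_coeff k = 1 / fact (Suc k)"

lemma summable_inverse_fact: "summable (\<lambda>k. \<bar>1 / fact k\<bar> * r ^ k :: real)"
  using summable_exp_generic[of r] by (simp add: field_simps)

lemma summable_phi1_coeff: "r \<ge> 0 \<Longrightarrow> summable (\<lambda>k. \<bar>phi1_coeff k\<bar> * r ^ k)"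
  by (rule summable_comparison_test'[OF summable_inverse_fact[of r], where N = 0])
     (auto simp: phi1_coeff_def abs_mult intro!: mult_right_mono divide_left_mono fact_mono
           simp del: fact_Suc)

text \<open>The exponential series under the integral converges uniformly on the unit interval, so it may
  be integrated term by term. This puts \<open>\<phi>\<^sub>1\<close> and \<open>b\<^sub>2\<close> on the same footing: the estimates for
  power series apply to both.\<close>

lemma phi_1_eq_op_series: "phi 1 A = op_series phi1_coeff A"
proof -
  define p where "p k \<theta> = (1 / fact k) *\<^sub>R op_power ((1 - \<theta>) *\<^sub>R A) k" for k and \<theta> :: real
  have nrm: "norm ((1 - \<theta>) *\<^sub>R A) \<le> norm A" if "\<theta> \<in> {0..1}" for \<theta> :: real
    using that by (auto intro: mult_left_le_one_le)
  have u: "uniform_limit {0..1} (\<lambda>n \<theta>. \<Sum>k<n. p k \<theta>) (\<lambda>\<theta>. op_exp ((1 - \<theta>) *\<^sub>R A)) sequentially"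
    unfolding p_def op_exp_def op_series_def
    by (rule Weierstrass_m_test[OF _ summable_inverse_fact[of "norm A"]])
       (rule op_series_term_le[OF nrm])
  have int_p: "(p k has_integral phi1_coeff k *\<^sub>R op_power A k) {0..1}" for k
  proof -
    have "((\<lambda>\<theta>::real. (1 - \<theta>) ^ k) has_integral (1 / (real k + 1))) {0..1}"
    proof -
      have "((\<lambda>\<theta>::real. (1 - \<theta>) ^ k) has_integral
          (- ((1 - 1) ^ Suc k / (real k + 1)) - - ((1 - 0) ^ Suc k / (real k + 1)))) {0..1}"
      proof (rule fundamental_theorem_of_calculus)
        fix \<theta> :: real
        have "((\<lambda>\<theta>. - ((1 - \<theta>) ^ Suc k / (real k + 1))) has_real_derivative (1 - \<theta>) ^ k)
            (at \<theta> within {0..1})"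
          by (auto intro!: derivative_eq_intros simp del: power_Suc) (simp add: field_simps)
        then show "((\<lambda>\<theta>. - ((1 - \<theta>) ^ Suc k / (real k + 1))) has_vector_derivative (1 - \<theta>) ^ k)
            (at \<theta> within {0..1})"
          by (simp add: has_real_derivative_iff_has_vector_derivative)
      qed simp
      then show ?thesis by simp
    qed
    from has_integral_scaleR_left[OF this, of "(1 / fact k) *\<^sub>R op_power A k"]
    show ?thesis
      by (rule has_integral_eq_rhs[OF has_integral_eq, rotated])
         (simp_all add: p_def op_power_scaleR phi1_coeff_def mult.commute add.commute)
  qed
  have cont: "continuous_on {0..1} (\<lambda>\<theta>. \<Sum>k<n. p k \<theta>)" for n
    unfolding p_def op_power_scaleR by (intro continuous_intros)
  obtain I J where IJ: "\<And>n. ((\<lambda>\<theta>. \<Sum>k<n. p k \<theta>) has_integral I n) {0..1}"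
      "((\<lambda>\<theta>. op_exp ((1 - \<theta>) *\<^sub>R A)) has_integral J) {0..1}" "I \<longlonglongrightarrow> J"
    using uniform_limit_integral[OF u cont] by auto
  have "I n = (\<Sum>k<n. phi1_coeff k *\<^sub>R op_power A k)" for n
    using has_integral_sum[of "{..<n}" p "\<lambda>k. phi1_coeff k *\<^sub>R op_power A k" "{0..1}"] int_p IJ(1)
    by (auto intro: has_integral_unique)
  then have "I = (\<lambda>n. \<Sum>k<n. phi1_coeff k *\<^sub>R op_power A k)" by auto
  with IJ(3) have "(\<lambda>k. phi1_coeff k *\<^sub>R op_power A k) sums J" by (simp add: sums_def)
  then have "J = op_series phi1_coeff A" unfolding op_series_def by (rule sums_unique)
  moreover have "phi 1 A = J" unfolding phi_def using IJ(2) by (simp add: integral_unique)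
  ultimately show ?thesis by simp
qed

section \<open>Taylor expansion on a normed space\<close>

text \<open>The mean value inequality in the form used to raise the order of an estimate. The bound on the
  derivative is increasing, so it may be replaced by its value at the right endpoint; the factor
  \<open>1/(k + 1)\<close> that integration would give is discarded.\<close>

lemma norm_le_power_of_vector_derivative:
  fixes \<psi> :: "real \<Rightarrow> 'b::real_normed_vector"
  assumes "0 \<le> s" "0 \<le> C" "\<psi> 0 = 0"
    and deriv: "\<And>x. x \<in> {0..s} \<Longrightarrow> (\<psi> has_vector_derivative \<psi>' x) (at x within {0..s})"
    and le: "\<And>x. x \<in> {0..s} \<Longrightarrow> norm (\<psi>' x) \<le> C * x ^ k"
  shows "norm (\<psi> s) \<le> C * s ^ Suc k"
proof -
  have "norm (\<psi> s - \<psi> 0) \<le> (C * s ^ k) * norm (s - 0)"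
  proof (rule differentiable_bound[where S = "{0..s}" and f' = "\<lambda>x h. h *\<^sub>R \<psi>' x"])
    fix x assume x: "x \<in> {0..s}"
    show "(\<psi> has_derivative (\<lambda>h. h *\<^sub>R \<psi>' x)) (at x within {0..s})"
      using deriv[OF x] by (simp add: has_vector_derivative_def)
    have "C * x ^ k \<le> C * s ^ k" using x assms(2) by (intro mult_left_mono power_mono) auto
    then have "norm (\<psi>' x) \<le> C * s ^ k" using le[OF x] by linarith
    then show "onorm (\<lambda>h. h *\<^sub>R \<psi>' x) \<le> C * s ^ k"
      using assms by (intro onorm_bound) (auto simp: mult.commute[of _ "\<bar>_\<bar>"] intro: mult_left_mono)
  qed (use assms in auto)
  then show ?thesis using assms by (simp add: mult_ac)
qed

lemma fderiv_has_derivative: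
  assumes "f differentiable (at x)"
  shows "(f has_derivative blinfun_apply (fderiv f x)) (at x)"
  using assms unfolding fderiv_def frechet_derivative_works
  by (metis bounded_linear_Blinfun_apply has_derivative_bounded_linear)

lemma fderiv_along_line:
  assumes "f differentiable (at (y + x *\<^sub>R w))"
  shows "((\<lambda>x. f (y + x *\<^sub>R w)) has_vector_derivative fderiv f (y + x *\<^sub>R w) w) (at x within X)"
proof -
  have "((\<lambda>x. y + x *\<^sub>R w) has_derivative (\<lambda>h. h *\<^sub>R w)) (at x within X)"
    by (auto intro!: derivative_eq_intros)
  from has_derivative_compose[OF this fderiv_has_derivative[OF assms]]
  show ?thesis by (simp add: has_vector_derivative_def blinfun.scaleR_right)
qed

lemma has_vector_derivative_power_scaleR:
  "((\<lambda>x::real. (x ^ n / d) *\<^sub>R v) has_vector_derivative (real n * x ^ (n - 1) / d) *\<^sub>R v) (at x within X)"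
proof -
  have "((\<lambda>x. x ^ n / d) has_real_derivative (real n * x ^ (n - 1) / d)) (at x within X)"
    using DERIV_cdivide[OF DERIV_pow] by simp
  from has_vector_derivative_scaleR[OF this has_vector_derivative_const[of v]] show ?thesis by simp
qed

lemma has_vector_derivative_ident_scaleR:
  "((\<lambda>x::real. x *\<^sub>R v) has_vector_derivative v) (at x within X)"
  using has_vector_derivative_power_scaleR[of 1 1 v x X] by simp

text \<open>A strip need not be convex, but every argument below stays in a ball around a single point of
  the curve. The constant is the same for all these balls.\<close>

lemma lipschitz_on_convex_subsets:
  assumes "differentiable_bounded_on f S"
  shows "\<exists>L\<ge>0. \<forall>D x y. convex D \<longrightarrow> D \<subseteq> S \<longrightarrow> x \<in> D \<longrightarrow> y \<in> D \<longrightarrow> norm (f x - f y) \<le> L * norm (x - y)"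
proof -
  obtain L where L: "\<And>x. x \<in> S \<Longrightarrow> norm (fderiv f x) \<le> L" "L > 0"
    using assms unfolding differentiable_bounded_on_def bounded_pos by auto
  show ?thesis
  proof (intro exI[where x = L] conjI allI impI)
    fix D x y assume D: "convex D" "D \<subseteq> S" "x \<in> D" "y \<in> D"
    show "norm (f x - f y) \<le> L * norm (x - y)"
    proof (rule differentiable_bound[OF D(1) _ _ D(3) D(4)])
      fix z assume "z \<in> D"
      then have z: "z \<in> S" using D by auto
      then show "(f has_derivative blinfun_apply (fderiv f z)) (at z within D)"
        using assms unfolding differentiable_bounded_on_def
        by (blast intro: fderiv_has_derivative has_derivative_at_withinI)
      show "onorm (blinfun_apply (fderiv f z)) \<le> L"
        using L(1)[OF z] by (simp add: norm_blinfun.rep_eq)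
    qed
  qed (use L in auto)
qed

text \<open>The third derivative is Lipschitz on balls, since its own derivative is bounded there. Integrating
  that estimate three times along the segment from \<open>y\<close> to \<open>y + w\<close> gives the fourth-order bound.\<close>

lemma taylor_third_order:
  fixes F :: "'a::real_normed_vector \<Rightarrow> 'b::real_normed_vector"
  assumes "four_times_differentiable_bounded_on F S"
  shows "\<exists>L\<ge>0. \<forall>y r w. ball y r \<subseteq> S \<longrightarrow> norm w < r \<longrightarrow>
    norm (F (y + w) - F y - fderiv F y w - (1 / 2) *\<^sub>R fderiv (fderiv F) y w w
          - (1 / 6) *\<^sub>R fderiv (fderiv (fderiv F)) y w w w) \<le> L * norm w ^ 4"
proof -
  let ?F1 = "fderiv F" and ?F2 = "fderiv (fderiv F)" and ?F3 = "fderiv (fderiv (fderiv F))"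
  obtain L where "L \<ge> 0" and L: "\<And>D x y. convex D \<Longrightarrow> D \<subseteq> S \<Longrightarrow> x \<in> D \<Longrightarrow> y \<in> D \<Longrightarrow>
      norm (?F3 x - ?F3 y) \<le> L * norm (x - y)"
    using assms lipschitz_on_convex_subsets[of ?F3 S]
    unfolding four_times_differentiable_bounded_on_def by blast
  have diff: "F differentiable (at x)" "?F1 differentiable (at x)" "?F2 differentiable (at x)"
    if "x \<in> S" for x
    using assms that
    unfolding four_times_differentiable_bounded_on_def differentiable_bounded_on_def by auto
  show ?thesis
  proof (intro exI[where x = L] conjI allI impI)
    fix y w :: 'a and r :: real assume r: "ball y r \<subseteq> S" "norm w < r"
    have line: "y + x *\<^sub>R w \<in> ball y r" if "x \<in> {0..1}" for x
    proof -
      have "\<bar>x\<bar> * norm w \<le> norm w" using that by (intro mult_left_le_one_le) auto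
      then show ?thesis using r by (simp add: dist_norm)
    qed
    note diff_line = diff[OF subsetD[OF r(1) line]]
    \<comment> \<open>The Taylor remainders of the derivatives along the segment: each is an antiderivative of the
      next one applied to \<open>w\<close>.\<close>
    define R2 where "R2 x = ?F2 (y + x *\<^sub>R w) - ?F2 y - x *\<^sub>R ?F3 y w" for x
    define R1 where "R1 x = ?F1 (y + x *\<^sub>R w) - ?F1 y - x *\<^sub>R ?F2 y w
      - (x ^ 2 / 2) *\<^sub>R ?F3 y w w" for x
    define R0 where "R0 x = F (y + x *\<^sub>R w) - F y - x *\<^sub>R ?F1 y w
      - (x ^ 2 / 2) *\<^sub>R ?F2 y w w - (x ^ 3 / 6) *\<^sub>R ?F3 y w w w" for x
    have R3: "norm ((?F3 (y + x *\<^sub>R w) - ?F3 y) w) \<le> (L * norm w ^ 2) * x ^ 1" if x: "x \<in> {0..1}" for x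
    proof -
      have "norm (?F3 (y + x *\<^sub>R w) - ?F3 y) \<le> L * norm (x *\<^sub>R w)"
        using L[OF convex_ball r(1) line[OF x] line[of 0]] by simp
      then have "norm (?F3 (y + x *\<^sub>R w) - ?F3 y) * norm w \<le> (L * norm (x *\<^sub>R w)) * norm w"
        by (intro mult_right_mono) auto
      then show ?thesis using x
        by (intro order_trans[OF norm_blinfun]) (simp add: power2_eq_square mult_ac)
    qed
    have R2: "norm (R2 s) \<le> (L * norm w ^ 2) * s ^ 2" if s: "s \<in> {0..1}" for s
    proof -
      have "norm (R2 s) \<le> (L * norm w ^ 2) * s ^ Suc 1"
      proof (rule norm_le_power_of_vector_derivative[where \<psi>' = "\<lambda>x. (?F3 (y + x *\<^sub>R w) - ?F3 y) w"])
        fix x assume "x \<in> {0..s}"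
        then have x: "x \<in> {0..1}" using s by auto
        have "(R2 has_vector_derivative
            ?F3 (y + x *\<^sub>R w) w - 0 - ?F3 y w) (at x within {0..s})"
          unfolding R2_def [abs_def]
          by (intro has_vector_derivative_diff has_vector_derivative_const fderiv_along_line diff_line x
              has_vector_derivative_power_scaleR has_vector_derivative_ident_scaleR)
        then show "(R2 has_vector_derivative (?F3 (y + x *\<^sub>R w) - ?F3 y) w) (at x within {0..s})"
          by (simp add: blinfun.bilinear_simps)
        show "norm ((?F3 (y + x *\<^sub>R w) - ?F3 y) w) \<le> (L * norm w ^ 2) * x ^ 1" by (rule R3[OF x])
      qed (use s \<open>L \<ge> 0\<close> in \<open>auto simp: R2_def\<close>)
      then show ?thesis by (simp add: power2_eq_square)
    qed
    have R1: "norm (R1 s) \<le> (L * norm w ^ 3) * s ^ 3" if s: "s \<in> {0..1}" for s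
    proof -
      have "norm (R1 s) \<le> (L * norm w ^ 3) * s ^ Suc 2"
      proof (rule norm_le_power_of_vector_derivative[where \<psi>' = "\<lambda>x. R2 x w"])
        fix x assume "x \<in> {0..s}"
        then have x: "x \<in> {0..1}" using s by auto
        have "(R1 has_vector_derivative
            ?F2 (y + x *\<^sub>R w) w - 0 - ?F2 y w - (real 2 * x ^ (2 - 1) / 2) *\<^sub>R ?F3 y w w) (at x within {0..s})"
          unfolding R1_def [abs_def]
          by (intro has_vector_derivative_diff has_vector_derivative_const fderiv_along_line diff_line x
              has_vector_derivative_power_scaleR has_vector_derivative_ident_scaleR)
        then show "(R1 has_vector_derivative R2 x w) (at x within {0..s})"
          by (simp add: R2_def blinfun.bilinear_simps)
        show "norm (R2 x w) \<le> (L * norm w ^ 3) * x ^ 2"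
          using mult_right_mono[OF R2[OF x], of "norm w"]
          by (intro order_trans[OF norm_blinfun]) (simp add: power_Suc mult_ac eval_nat_numeral)
      qed (use s \<open>L \<ge> 0\<close> in \<open>auto simp: R1_def\<close>)
      then show ?thesis by (simp add: eval_nat_numeral)
    qed
    have "norm (R0 1) \<le> (L * norm w ^ 4) * 1 ^ Suc 3"
    proof (rule norm_le_power_of_vector_derivative[where \<psi>' = "\<lambda>x. R1 x w"])
      fix x :: real assume x: "x \<in> {0..1}"
      have "(R0 has_vector_derivative
            ?F1 (y + x *\<^sub>R w) w - 0 - ?F1 y w - (real 2 * x ^ (2 - 1) / 2) *\<^sub>R ?F2 y w w - (real 3 * x ^ (3 - 1) / 6) *\<^sub>R ?F3 y w w w) (at x within {0..1})"
          unfolding R0_def [abs_def]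
          by (intro has_vector_derivative_diff has_vector_derivative_const fderiv_along_line diff_line x
              has_vector_derivative_power_scaleR has_vector_derivative_ident_scaleR)
        then show "(R0 has_vector_derivative R1 x w) (at x within {0..1})"
          by (simp add: R1_def blinfun.bilinear_simps)
      show "norm (R1 x w) \<le> (L * norm w ^ 4) * x ^ 3"
        using mult_right_mono[OF R1[OF x], of "norm w"]
        by (intro order_trans[OF norm_blinfun]) (simp add: mult_ac eval_nat_numeral)
    qed (use \<open>L \<ge> 0\<close> in \<open>auto simp: R0_def\<close>)
    then show "norm (F (y + w) - F y - ?F1 y w - (1 / 2) *\<^sub>R ?F2 y w w - (1 / 6) *\<^sub>R ?F3 y w w w)
        \<le> L * norm w ^ 4"
      by (simp add: R0_def)
  qed (rule \<open>L \<ge> 0\<close>)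
qed

section \<open>Uniform order estimates\<close>

text \<open>A bound up to a constant that does not depend on the index. It is the \<open>O\<close>-notation with uniform
  constants over the whole index set instead of a limit, and for vector- and operator-valued
  families. The comparison function is a power of the step size in the consistency part, and the
  distance of two points in the stability part.\<close>

definition dominated :: "'p set \<Rightarrow> ('p \<Rightarrow> 'b::real_normed_vector) \<Rightarrow> ('p \<Rightarrow> real) \<Rightarrow> bool" where
  "dominated P f g \<longleftrightarrow> (\<exists>C\<ge>0. \<forall>p\<in>P. norm (f p) \<le> C * g p)"

lemma dominatedI:
  "0 \<le> C \<Longrightarrow> (\<And>p. p \<in> P \<Longrightarrow> norm (f p) \<le> C * g p) \<Longrightarrow> dominated P f g"
  unfolding dominated_def by auto

lemma dominatedE:
  assumes "dominated P f g"
  obtains C where "0 \<le> C" "\<And>p. p \<in> P \<Longrightarrow> norm (f p) \<le> C * g p"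
  using assms unfolding dominated_def by auto

text \<open>Used throughout to establish an expansion: the error term is rewritten as a combination of
  families that are already estimated.\<close>

lemma dominated_cong:
  assumes "dominated P f g" "\<And>p. p \<in> P \<Longrightarrow> f' p = f p"
  shows "dominated P f' g"
  using assms unfolding dominated_def by auto

lemma dominated_mono:
  assumes "dominated P f g" "0 \<le> c" "\<And>p. p \<in> P \<Longrightarrow> g p \<le> c * h p"
  shows "dominated P f h"
proof -
  obtain C where C: "0 \<le> C" "\<And>p. p \<in> P \<Longrightarrow> norm (f p) \<le> C * g p" using assms(1) by (rule dominatedE) blast
  show ?thesis
  proof (rule dominatedI[of "C * c"])
    fix p assume p: "p \<in> P"
    show "norm (f p) \<le> C * c * h p"
      using C(2)[OF p] mult_left_mono[OF assms(3)[OF p] C(1)] by (simp add: mult.assoc)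
  qed (use C assms in auto)
qed

lemma dominated_add:
  assumes "dominated P f g" "dominated P f' g"
  shows "dominated P (\<lambda>p. f p + f' p) g"
proof -
  obtain C where C: "0 \<le> C" "\<And>p. p \<in> P \<Longrightarrow> norm (f p) \<le> C * g p" using assms(1) by (rule dominatedE) blast
  obtain D where D: "0 \<le> D" "\<And>p. p \<in> P \<Longrightarrow> norm (f' p) \<le> D * g p" using assms(2) by (rule dominatedE) blast
  show ?thesis
  proof (rule dominatedI[of "C + D"])
    fix p assume p: "p \<in> P"
    show "norm (f p + f' p) \<le> (C + D) * g p"
      using norm_triangle_ineq[of "f p" "f' p"] C(2)[OF p] D(2)[OF p] by (simp add: distrib_right)
  qed (use C D in auto)
qed

lemma dominated_const_scaleR:
  assumes "dominated P f g"
  shows "dominated P (\<lambda>p. c *\<^sub>R f p) g"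
proof -
  obtain C where C: "0 \<le> C" "\<And>p. p \<in> P \<Longrightarrow> norm (f p) \<le> C * g p" using assms(1) by (rule dominatedE) blast
  show ?thesis
    by (rule dominatedI[of "\<bar>c\<bar> * C"]) (use C in \<open>auto simp: mult.assoc intro: mult_left_mono\<close>)
qed

lemma dominated_diff:
  assumes "dominated P f g" "dominated P f' g"
  shows "dominated P (\<lambda>p. f p - f' p) g"
  using dominated_add[OF assms(1) dominated_const_scaleR[OF assms(2), of "-1"]] by simp

lemma dominated_prod:
  assumes "bounded_bilinear b" "dominated P f g" "dominated P f' g'"
  shows "dominated P (\<lambda>p. b (f p) (f' p)) (\<lambda>p. g p * g' p)"
proof -
  obtain C where C: "0 \<le> C" "\<And>p. p \<in> P \<Longrightarrow> norm (f p) \<le> C * g p" using assms(2) by (rule dominatedE) blast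
  obtain D where D: "0 \<le> D" "\<And>p. p \<in> P \<Longrightarrow> norm (f' p) \<le> D * g' p" using assms(3) by (rule dominatedE) blast
  obtain K where K: "0 \<le> K" "\<And>x y. norm (b x y) \<le> norm x * norm y * K"
    using bounded_bilinear.nonneg_bounded[OF assms(1)] by auto
  show ?thesis
  proof (rule dominatedI[of "C * D * K"])
    fix p assume p: "p \<in> P"
    have "norm (b (f p) (f' p)) \<le> norm (f p) * norm (f' p) * K" by (rule K)
    also have "\<dots> \<le> (C * g p) * (D * g' p) * K"
      using C(2)[OF p] D(2)[OF p] K(1)
      by (intro mult_right_mono mult_mono) (auto intro: order_trans[OF norm_ge_zero])
    finally show "norm (b (f p) (f' p)) \<le> C * D * K * (g p * g' p)" by (simp add: mult_ac)
  qed (use C D K in auto)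
qed

lemma dominated_self: "(\<And>p. p \<in> P \<Longrightarrow> 0 \<le> g p) \<Longrightarrow> dominated P g g"
  by (rule dominatedI[of 1]) auto

lemmas dominated_apply = dominated_prod[OF bounded_bilinear_blinfun_apply]
lemmas dominated_scaleR = dominated_prod[OF bounded_bilinear_scaleR]

text \<open>Families over an index set that carries a step size. The step sizes lie in the unit interval so
  that higher powers are dominated by lower ones.\<close>

locale small_steps =
  fixes P :: "'p set" and s :: "'p \<Rightarrow> real"
  assumes step_range: "p \<in> P \<Longrightarrow> 0 \<le> s p \<and> s p \<le> 1"
begin

abbreviation O_step :: "nat \<Rightarrow> ('p \<Rightarrow> 'b::real_normed_vector) \<Rightarrow> bool" where
  "O_step k f \<equiv> dominated P f (\<lambda>p. s p ^ k)"

lemma O_weaken: "O_step j f \<Longrightarrow> k \<le> j \<Longrightarrow> O_step k f"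
  by (erule dominated_mono[where c = 1]) (auto simp: step_range intro: power_decreasing)

lemma O_scale: "O_step j f \<Longrightarrow> k \<le> i + j \<Longrightarrow> O_step k (\<lambda>p. s p ^ i *\<^sub>R f p)"
  by (rule O_weaken[where j = "i + j"], simp only: power_add)
     (auto intro!: dominated_scaleR dominated_self simp: step_range)

lemma O_scale1: "O_step j f \<Longrightarrow> k \<le> Suc j \<Longrightarrow> O_step k (\<lambda>p. s p *\<^sub>R f p)"
  using O_scale[where j = j and f = f and k = k and i = 1] by simp

lemma O_apply:
  "O_step i A \<Longrightarrow> O_step j x \<Longrightarrow> k \<le> i + j \<Longrightarrow> O_step k (\<lambda>p. blinfun_apply (A p) (x p))"
  by (rule O_weaken[where j = "i + j"], simp only: power_add) (auto intro!: dominated_apply)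

end

section \<open>Expanding the nonlinear remainder and the scheme's operator functions\<close>

text \<open>With \<open>J\<close>, \<open>B\<close>, \<open>Q\<close> the first three derivatives of a vector field and \<open>f\<close> its value at a point,
  these are the coefficients of \<open>s\<^sup>2\<close> and \<open>s\<^sup>3\<close> in the nonlinear remainder along
  \<open>w = s f + s\<^sup>2/2 J f\<close>. The second derivative \<open>B\<close> appears with both orders of its arguments,
  as it does in the expansion of \<open>B(w,w)\<close>.\<close>

definition quadratic_part :: "('a::real_normed_vector \<Rightarrow>\<^sub>L 'a \<Rightarrow>\<^sub>L 'a) \<Rightarrow> 'a \<Rightarrow> 'a" where
  "quadratic_part B f = (1 / 2) *\<^sub>R B f f"

definition cubic_part :: "('a::real_normed_vector \<Rightarrow>\<^sub>L 'a) \<Rightarrow> ('a \<Rightarrow>\<^sub>L 'a \<Rightarrow>\<^sub>L 'a) \<Rightarrow>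
    ('a \<Rightarrow>\<^sub>L 'a \<Rightarrow>\<^sub>L 'a \<Rightarrow>\<^sub>L 'a) \<Rightarrow> 'a \<Rightarrow> 'a" where
  "cubic_part J B Q f = (1 / 4) *\<^sub>R (B f (J f) + B (J f) f) + (1 / 6) *\<^sub>R Q f f f"

context small_steps
begin

lemma O_quadratic_part:
  fixes f :: "'p \<Rightarrow> 'a::real_normed_vector"
  assumes B: "O_step 0 B" and f: "O_step 0 f"
  shows "O_step 0 (\<lambda>p. quadratic_part (B p) (f p))"
  unfolding quadratic_part_def
  by (intro dominated_const_scaleR O_apply[OF O_apply[OF B f order_refl] f]) simp

lemma O_cubic_part:
  fixes f :: "'p \<Rightarrow> 'a::real_normed_vector"
  assumes f: "O_step 0 f" and J: "O_step 0 J" and B: "O_step 0 B" and Q: "O_step 0 Q"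
  shows "O_step 0 (\<lambda>p. cubic_part (J p) (B p) (Q p) (f p))"
proof -
  note Jf = O_apply[OF J f order_refl]
  show ?thesis
    unfolding cubic_part_def
    by (intro dominated_add dominated_const_scaleR O_apply[OF O_apply[OF B f order_refl] Jf]
        O_apply[OF O_apply[OF B Jf order_refl] f]
        O_apply[OF O_apply[OF O_apply[OF Q f order_refl] f order_refl] f]) simp_all
qed

text \<open>The second-order expansion of the increment \<open>w\<close> determines the third-order expansion of the
  remainder, because the linear part has been split off: \<open>r\<close> is quadratic in \<open>w\<close>, so an error
  \<open>O(s\<^sup>3)\<close> in \<open>w\<close> is multiplied by \<open>w = O(s)\<close>. The lemma serves both the exact solution and, with
  \<open>s\<close> replaced by \<open>3/4 h\<close>, the internal stage.\<close>

lemma remainder_expansion: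
  fixes f w r :: "'p \<Rightarrow> 'a::real_normed_vector"
    and J :: "'p \<Rightarrow> 'a \<Rightarrow>\<^sub>L 'a" and B :: "'p \<Rightarrow> 'a \<Rightarrow>\<^sub>L 'a \<Rightarrow>\<^sub>L 'a"
    and Q :: "'p \<Rightarrow> 'a \<Rightarrow>\<^sub>L 'a \<Rightarrow>\<^sub>L 'a \<Rightarrow>\<^sub>L 'a"
  assumes f: "O_step 0 f" and J: "O_step 0 J" and B: "O_step 0 B" and Q: "O_step 0 Q"
    and w: "O_step 3 (\<lambda>p. w p - s p *\<^sub>R f p - (s p ^ 2 / 2) *\<^sub>R J p (f p))"
    and r: "dominated P (\<lambda>p. r p - (1 / 2) *\<^sub>R B p (w p) (w p) - (1 / 6) *\<^sub>R Q p (w p) (w p) (w p))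
              (\<lambda>p. norm (w p) ^ 4)"
  shows "O_step 4 (\<lambda>p. r p - s p ^ 2 *\<^sub>R quadratic_part (B p) (f p)
                         - s p ^ 3 *\<^sub>R cubic_part (J p) (B p) (Q p) (f p))"
proof -
  define e2 where "e2 p = w p - s p *\<^sub>R f p" for p
  define e3 where "e3 p = w p - s p *\<^sub>R f p - (s p ^ 2 / 2) *\<^sub>R J p (f p)" for p
  define q where "q p = s p *\<^sub>R f p + (s p ^ 2 / 2) *\<^sub>R J p (f p)" for p
  have Jf: "O_step 0 (\<lambda>p. J p (f p))" by (rule O_apply[OF J f]) simp
  have e3: "O_step 3 e3" using w unfolding e3_def .
  have s2Jf: "O_step 2 (\<lambda>p. (1 / 2) *\<^sub>R (s p ^ 2 *\<^sub>R J p (f p)))"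
    by (intro dominated_const_scaleR O_scale[OF Jf]) simp
  have e2: "O_step 2 e2"
    by (rule dominated_cong[OF dominated_add[OF O_weaken[OF e3] s2Jf]]) (auto simp: e2_def e3_def)
  have sf: "O_step 1 (\<lambda>p. s p *\<^sub>R f p)" by (rule O_scale1[OF f]) simp
  have q: "O_step 1 q"
    by (rule dominated_cong[OF dominated_add[OF sf O_weaken[OF s2Jf]]]) (auto simp: q_def)
  have w1: "O_step 1 w"
    by (rule dominated_cong[OF dominated_add[OF sf O_weaken[OF e2]]]) (auto simp: e2_def)
  have r': "O_step 4 (\<lambda>p. r p - (1 / 2) *\<^sub>R B p (w p) (w p) - (1 / 6) *\<^sub>R Q p (w p) (w p) (w p))"
  proof -
    obtain C where C: "0 \<le> C" "\<And>p. p \<in> P \<Longrightarrow> norm (w p) \<le> C * s p ^ 1" using w1 by (rule dominatedE) blast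
    show ?thesis
    proof (rule dominated_mono[OF r, of "C ^ 4"])
      fix p assume "p \<in> P"
      then have "norm (w p) ^ 4 \<le> (C * s p) ^ 4" using C(2) by (intro power_mono) auto
      then show "norm (w p) ^ 4 \<le> C ^ 4 * s p ^ 4" by (simp add: power_mult_distrib)
    qed (use C in auto)
  qed
  \<comment> \<open>What is left of \<open>B(w,w)\<close> and of \<open>Q(w,w,w)\<close> after the terms of order two and three are removed.\<close>
  have b: "O_step 4 (\<lambda>p. (1 / 2) *\<^sub>R (B p (e3 p) (w p) + B p (q p) (e3 p)
      + (1 / 4) *\<^sub>R (s p ^ 4 *\<^sub>R B p (J p (f p)) (J p (f p)))))"
    by (intro dominated_const_scaleR dominated_add O_scale[where j = 0]
        O_apply[OF O_apply[OF B e3 order_refl] w1] O_apply[OF O_apply[OF B q order_refl] e3]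
        O_apply[OF O_apply[OF B Jf order_refl] Jf]) simp_all
  have c: "O_step 4 (\<lambda>p. (1 / 6) *\<^sub>R (Q p (e2 p) (w p) (w p) + Q p (s p *\<^sub>R f p) (e2 p) (w p)
      + Q p (s p *\<^sub>R f p) (s p *\<^sub>R f p) (e2 p)))"
    by (intro dominated_const_scaleR dominated_add
        O_apply[OF O_apply[OF O_apply[OF Q e2 order_refl] w1 order_refl] w1]
        O_apply[OF O_apply[OF O_apply[OF Q sf order_refl] e2 order_refl] w1]
        O_apply[OF O_apply[OF O_apply[OF Q sf order_refl] sf order_refl] e2]) simp_all
  show ?thesis
  proof (rule dominated_cong[OF dominated_add[OF dominated_add[OF r' b] c]])
    fix p
    have "B p (w p) (w p) = B p (e3 p) (w p) + B p (q p) (e3 p) + B p (q p) (q p)"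
      by (simp add: e3_def q_def blinfun.bilinear_simps algebra_simps)
    moreover have "B p (q p) (q p) = s p ^ 2 *\<^sub>R B p (f p) (f p)
        + (s p ^ 3 / 2) *\<^sub>R (B p (f p) (J p (f p)) + B p (J p (f p)) (f p))
        + (1 / 4) *\<^sub>R (s p ^ 4 *\<^sub>R B p (J p (f p)) (J p (f p)))"
      by (simp add: q_def blinfun.bilinear_simps algebra_simps power2_eq_square power3_eq_cube
          power4_eq_xxxx)
    moreover have "Q p (w p) (w p) (w p) = Q p (e2 p) (w p) (w p) + Q p (s p *\<^sub>R f p) (e2 p) (w p)
        + Q p (s p *\<^sub>R f p) (s p *\<^sub>R f p) (e2 p) + s p ^ 3 *\<^sub>R Q p (f p) (f p) (f p)"
      by (simp add: e2_def blinfun.bilinear_simps algebra_simps power3_eq_cube)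
    ultimately show "r p - s p ^ 2 *\<^sub>R quadratic_part (B p) (f p)
        - s p ^ 3 *\<^sub>R cubic_part (J p) (B p) (Q p) (f p) =
      r p - (1 / 2) *\<^sub>R B p (w p) (w p) - (1 / 6) *\<^sub>R Q p (w p) (w p) (w p)
      + (1 / 2) *\<^sub>R (B p (e3 p) (w p) + B p (q p) (e3 p)
          + (1 / 4) *\<^sub>R (s p ^ 4 *\<^sub>R B p (J p (f p)) (J p (f p))))
      + (1 / 6) *\<^sub>R (Q p (e2 p) (w p) (w p) + Q p (s p *\<^sub>R f p) (e2 p) (w p)
          + Q p (s p *\<^sub>R f p) (s p *\<^sub>R f p) (e2 p))"
      unfolding quadratic_part_def cubic_part_def by (simp add: algebra_simps)
  qed
qed

end

context small_steps
begin

lemma op_series_expansion: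
  fixes A :: "'p \<Rightarrow> 'a::banach \<Rightarrow>\<^sub>L 'a"
  assumes "summable (\<lambda>k. \<bar>\<gamma> k\<bar> * r ^ k)" "r > 0" and le: "\<And>p. p \<in> P \<Longrightarrow> norm (A p) \<le> r"
    and A: "O_step 1 A"
  shows "O_step m (\<lambda>p. op_series \<gamma> (A p) - (\<Sum>k<m. \<gamma> k *\<^sub>R op_power (A p) k))"
proof -
  obtain C where C: "C \<ge> 0" "\<And>A::'a \<Rightarrow>\<^sub>L 'a. norm A \<le> r \<Longrightarrow>
      norm (op_series \<gamma> A - (\<Sum>k<m. \<gamma> k *\<^sub>R op_power A k)) \<le> C * norm A ^ m"
    using op_series_remainder[OF assms(1,2)] by blast
  obtain D where D: "0 \<le> D" "\<And>p. p \<in> P \<Longrightarrow> norm (A p) \<le> D * s p ^ 1"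
    using A by (rule dominatedE) blast
  show ?thesis
  proof (rule dominatedI[of "C * D ^ m"])
    fix p assume p: "p \<in> P"
    have "norm (A p) ^ m \<le> (D * s p) ^ m" using D(2)[OF p] by (intro power_mono) auto
    then have "C * norm (A p) ^ m \<le> C * D ^ m * s p ^ m"
      using C(1) by (simp add: power_mult_distrib mult.assoc mult_left_mono)
    then show "norm (op_series \<gamma> (A p) - (\<Sum>k<m. \<gamma> k *\<^sub>R op_power (A p) k)) \<le> C * D ^ m * s p ^ m"
      using C(2)[OF le[OF p]] by linarith
  qed (use C D in auto)
qed

text \<open>The radius may be chosen as large as the family requires, because the series of \<open>\<phi>\<^sub>1\<close> converges
  everywhere.\<close>

lemma phi_1_expansion:
  fixes f :: "'p \<Rightarrow> 'a::banach" and J :: "'p \<Rightarrow> 'a \<Rightarrow>\<^sub>L 'a"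
  assumes J: "O_step 0 J" and f: "O_step 0 f"
  shows "O_step (Suc m) (\<lambda>p. s p *\<^sub>R phi 1 (s p *\<^sub>R J p) (f p)
           - s p *\<^sub>R (\<Sum>k<m. phi1_coeff k *\<^sub>R op_power (s p *\<^sub>R J p) k) (f p))"
proof -
  have sJ: "O_step 1 (\<lambda>p. s p *\<^sub>R J p)" by (rule O_scale1[OF J]) simp
  obtain D where D: "0 \<le> D" "\<And>p. p \<in> P \<Longrightarrow> norm (s p *\<^sub>R J p) \<le> D * s p ^ 1"
    using sJ by (rule dominatedE) blast
  have le: "norm (s p *\<^sub>R J p) \<le> D + 1" if "p \<in> P" for p
    using D(2)[OF that] mult_left_mono[of "s p" 1 D] step_range[OF that] D(1) by simp
  have "O_step m (\<lambda>p. op_series phi1_coeff (s p *\<^sub>R J p)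
      - (\<Sum>k<m. phi1_coeff k *\<^sub>R op_power (s p *\<^sub>R J p) k))"
    by (rule op_series_expansion[OF summable_phi1_coeff _ le sJ]) (use D in auto)
  from O_scale1[OF O_apply[OF this f order_refl] order_refl]
  show ?thesis
    by (rule O_weaken[OF dominated_cong])
       (auto simp: phi_1_eq_op_series[unfolded One_nat_def] blinfun.diff_left scaleR_diff_right)
qed

lemma phi_1_expansion_2:
  fixes f :: "'p \<Rightarrow> 'a::banach" and J :: "'p \<Rightarrow> 'a \<Rightarrow>\<^sub>L 'a"
  assumes "O_step 0 J" "O_step 0 f"
  shows "O_step 3 (\<lambda>p. s p *\<^sub>R phi 1 (s p *\<^sub>R J p) (f p) - s p *\<^sub>R f p - (s p ^ 2 / 2) *\<^sub>R J p (f p))"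
  using phi_1_expansion[OF assms, of 2]
  by (simp add: eval_nat_numeral phi1_coeff_def op_power_Suc blinfun.bilinear_simps algebra_simps)

lemma phi_1_expansion_4:
  fixes f :: "'p \<Rightarrow> 'a::banach" and J :: "'p \<Rightarrow> 'a \<Rightarrow>\<^sub>L 'a"
  assumes "O_step 0 J" "O_step 0 f"
  shows "O_step 5 (\<lambda>p. s p *\<^sub>R phi 1 (s p *\<^sub>R J p) (f p) - s p *\<^sub>R f p - (s p ^ 2 / 2) *\<^sub>R J p (f p)
           - (s p ^ 3 / 6) *\<^sub>R J p (J p (f p)) - (s p ^ 4 / 24) *\<^sub>R J p (J p (J p (f p))))"
  using phi_1_expansion[OF assms, of 4]
  by (simp add: eval_nat_numeral phi1_coeff_def op_power_Suc blinfun.bilinear_simps algebra_simps)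

end

section \<open>Expansion of the exact solution\<close>

text \<open>Integration gains one order. The index pairs consist of a starting time and an elapsed time, and
  the set has to contain all shorter elapsed times for the same starting time.\<close>

lemma dominated_integrate:
  fixes f :: "'q \<times> real \<Rightarrow> 'b::real_normed_vector"
  assumes nonneg: "\<And>t h. (t, h) \<in> P \<Longrightarrow> 0 \<le> h"
    and down: "\<And>t h x. (t, h) \<in> P \<Longrightarrow> x \<in> {0..h} \<Longrightarrow> (t, x) \<in> P"
    and zero: "\<And>t. f (t, 0) = 0"
    and deriv: "\<And>t h x. (t, h) \<in> P \<Longrightarrow> x \<in> {0..h} \<Longrightarrow>
      ((\<lambda>x. f (t, x)) has_vector_derivative f' (t, x)) (at x within {0..h})"
    and f': "dominated P f' (\<lambda>p. snd p ^ k)"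
  shows "dominated P f (\<lambda>p. snd p ^ Suc k)"
proof -
  obtain C where C: "0 \<le> C" "\<And>p. p \<in> P \<Longrightarrow> norm (f' p) \<le> C * snd p ^ k"
    using f' by (rule dominatedE) blast
  show ?thesis
  proof (rule dominatedI[OF C(1)])
    fix p assume p: "p \<in> P"
    obtain t h where th: "p = (t, h)" by (cases p)
    show "norm (f p) \<le> C * snd p ^ Suc k"
      unfolding th snd_conv
    proof (rule norm_le_power_of_vector_derivative[where \<psi> = "\<lambda>x. f (t, x)" and \<psi>' = "\<lambda>x. f' (t, x)"])
      fix x assume x: "x \<in> {0..h}"
      show "((\<lambda>x. f (t, x)) has_vector_derivative f' (t, x)) (at x within {0..h})"
        by (rule deriv[OF p[unfolded th] x])
      show "norm (f' (t, x)) \<le> C * x ^ k"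
        using C(2)[OF down[OF p[unfolded th] x]] by simp
    qed (use nonneg p th C zero in auto)
  qed
qed

abbreviation fderiv2 where "fderiv2 F \<equiv> fderiv (fderiv F)"
abbreviation fderiv3 where "fderiv3 F \<equiv> fderiv (fderiv (fderiv F))"

definition taylor_remainder :: "('a::real_normed_vector \<Rightarrow> 'a) \<Rightarrow> 'a \<Rightarrow> 'a \<Rightarrow> 'a" where
  "taylor_remainder F y w = F (y + w) - F y - fderiv F y w"

text \<open>The data of the initial value problem with one constant \<open>K\<close> for all bounds that the proof uses:
  values and Lipschitz constants on balls of radius \<open>R\<close> around points of the solution curve, and a
  Taylor remainder at the points of the curve.\<close>

locale bounded_flow =
  fixes F :: "'a::banach \<Rightarrow> 'a" and u :: "real \<Rightarrow> 'a" and t0 T R K :: real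
  assumes R_pos: "0 < R" and K_ge_1: "1 \<le> K"
    and ode: "t \<in> {t0..T} \<Longrightarrow> (u has_vector_derivative F (u t)) (at t within {t0..T})"
    and F_le: "t \<in> {t0..T} \<Longrightarrow> v \<in> ball (u t) R \<Longrightarrow> norm (F v) \<le> K"
    and fderiv_le: "t \<in> {t0..T} \<Longrightarrow> v \<in> ball (u t) R \<Longrightarrow> norm (fderiv F v) \<le> K"
    and fderiv2_le: "t \<in> {t0..T} \<Longrightarrow> norm (fderiv2 F (u t)) \<le> K"
    and fderiv3_le: "t \<in> {t0..T} \<Longrightarrow> norm (fderiv3 F (u t)) \<le> K"
    and F_lipschitz: "t \<in> {t0..T} \<Longrightarrow> v \<in> ball (u t) R \<Longrightarrow> w \<in> ball (u t) R \<Longrightarrow>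
      norm (F v - F w) \<le> K * norm (v - w)"
    and fderiv_lipschitz: "t \<in> {t0..T} \<Longrightarrow> v \<in> ball (u t) R \<Longrightarrow> w \<in> ball (u t) R \<Longrightarrow>
      norm (fderiv F v - fderiv F w) \<le> K * norm (v - w)"
    and taylor_le: "t \<in> {t0..T} \<Longrightarrow> norm w < R \<Longrightarrow>
      norm (taylor_remainder F (u t) w - (1 / 2) *\<^sub>R fderiv2 F (u t) w w
            - (1 / 6) *\<^sub>R fderiv3 F (u t) w w w) \<le> K * norm w ^ 4"
begin

lemma solution_in_ball: "u t \<in> ball (u t) R"
  using R_pos by simp

definition steps :: "real \<Rightarrow> (real \<times> real) set" where
  "steps \<delta> = {(t, h). t0 \<le> t \<and> 0 \<le> h \<and> h \<le> \<delta> \<and> t + h \<le> T}"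

abbreviation "f0 \<equiv> (\<lambda>p :: real \<times> real. F (u (fst p)))"
abbreviation "J0 \<equiv> (\<lambda>p :: real \<times> real. fderiv F (u (fst p)))"
abbreviation "B0 \<equiv> (\<lambda>p :: real \<times> real. fderiv2 F (u (fst p)))"
abbreviation "Q0 \<equiv> (\<lambda>p :: real \<times> real. fderiv3 F (u (fst p)))"
abbreviation "quad0 \<equiv> (\<lambda>p. quadratic_part (B0 p) (f0 p))"
abbreviation "cub0 \<equiv> (\<lambda>p. cubic_part (J0 p) (B0 p) (Q0 p) (f0 p))"
abbreviation "increment \<equiv> (\<lambda>p :: real \<times> real. u (fst p + snd p) - u (fst p))"

lemma steps_fst: "p \<in> steps \<delta> \<Longrightarrow> fst p \<in> {t0..T}"
  unfolding steps_def by auto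

lemma data_bounded:
  "dominated (steps \<delta>) f0 (\<lambda>p. snd p ^ 0)" "dominated (steps \<delta>) J0 (\<lambda>p. snd p ^ 0)"
  "dominated (steps \<delta>) B0 (\<lambda>p. snd p ^ 0)" "dominated (steps \<delta>) Q0 (\<lambda>p. snd p ^ 0)"
  by (rule dominatedI[of K]; use K_ge_1 F_le fderiv_le fderiv2_le fderiv3_le steps_fst solution_in_ball
      in \<open>auto dest!: steps_fst\<close>)+

lemma increment_deriv:
  assumes "(t, h) \<in> steps \<delta>" "x \<in> {0..h}"
  shows "((\<lambda>x. increment (t, x)) has_vector_derivative F (u (t + x))) (at x within {0..h})"
proof -
  have x: "t + x \<in> {t0..T}" "(\<lambda>x. t + x) ` {0..h} \<subseteq> {t0..T}" using assms by (auto simp: steps_def)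
  have "((u \<circ> (\<lambda>x. t + x)) has_vector_derivative 1 *\<^sub>R F (u (t + x))) (at x within {0..h})"
  proof (rule vector_diff_chain_within)
    show "((\<lambda>x. t + x) has_vector_derivative 1) (at x within {0..h})"
      by (auto intro!: derivative_eq_intros)
    show "(u has_vector_derivative F (u (t + x))) (at (t + x) within (\<lambda>x. t + x) ` {0..h})"
      by (rule has_vector_derivative_within_subset[OF ode[OF x(1)] x(2)])
  qed
  from has_vector_derivative_diff[OF this has_vector_derivative_const[of "u t"]]
  show ?thesis by (simp add: o_def)
qed

lemma norm_increment_le:
  assumes "p \<in> steps \<delta>"
  shows "norm (increment p) \<le> K * snd p"
proof -
  obtain t h where p: "p = (t, h)" by (cases p)
  have "norm (increment (t, h)) \<le> K * h ^ Suc 0"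
  proof (rule norm_le_power_of_vector_derivative[where \<psi> = "\<lambda>x. increment (t, x)"])
    fix x assume x: "x \<in> {0..h}"
    show "((\<lambda>x. increment (t, x)) has_vector_derivative F (u (t + x))) (at x within {0..h})"
      by (rule increment_deriv[OF assms[unfolded p] x])
    have "t + x \<in> {t0..T}" using assms x by (auto simp: p steps_def)
    then show "norm (F (u (t + x))) \<le> K * x ^ 0" using F_le solution_in_ball by simp
  qed (use assms K_ge_1 in \<open>auto simp: p steps_def\<close>)
  then show ?thesis by (simp add: p)
qed

lemma taylor_dominated:
  assumes "\<And>p. p \<in> steps \<delta> \<Longrightarrow> norm (w p) < R"
  shows "dominated (steps \<delta>) (\<lambda>p. taylor_remainder F (u (fst p)) (w p)
      - (1 / 2) *\<^sub>R B0 p (w p) (w p) - (1 / 6) *\<^sub>R Q0 p (w p) (w p) (w p)) (\<lambda>p. norm (w p) ^ 4)"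
  by (rule dominatedI[of K]) (use K_ge_1 in \<open>auto intro!: taylor_le assms dest: steps_fst\<close>)

text \<open>The step size is limited so that the increment stays in the ball where Taylor's formula holds.
  In the result, \<open>h\<^sup>3/3\<close> and \<open>h\<^sup>4/4\<close> are the integrals of \<open>s\<^sup>2\<close> and \<open>s\<^sup>3\<close>, and \<open>h\<^sup>4/12\<close> is the integral
  of \<open>s\<^sup>3/3\<close>: the quadratic term fed back through \<open>J\<close>.\<close>

lemma exact_expansion:
  assumes \<delta>: "\<delta> \<le> 1" "K * \<delta> < R"
  shows "dominated (steps \<delta>) (\<lambda>p. increment p - snd p *\<^sub>R f0 p - (snd p ^ 2 / 2) *\<^sub>R J0 p (f0 p)
      - (snd p ^ 3 / 6) *\<^sub>R J0 p (J0 p (f0 p)) - (snd p ^ 3 / 3) *\<^sub>R quad0 p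
      - (snd p ^ 4 / 24) *\<^sub>R J0 p (J0 p (J0 p (f0 p))) - (snd p ^ 4 / 12) *\<^sub>R J0 p (quad0 p)
      - (snd p ^ 4 / 4) *\<^sub>R cub0 p) (\<lambda>p. snd p ^ 5)"
proof -
  interpret small_steps "steps \<delta>" snd
    by unfold_locales (use \<delta> in \<open>auto simp: steps_def\<close>)
  note data = data_bounded[of \<delta>]
  note J = data(2)
  define rem where "rem p = taylor_remainder F (u (fst p)) (increment p)" for p
  have F_eq: "F (u (t + x)) = f0 (t, x) + J0 (t, x) (increment (t, x)) + rem (t, x)" for t x
    by (simp add: rem_def taylor_remainder_def)
  have integrate: "O_step (Suc k) f"
    if "\<And>t. f (t, 0) = 0" "O_step k f'"
      "\<And>t h x. (t, h) \<in> steps \<delta> \<Longrightarrow> x \<in> {0..h} \<Longrightarrow>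
        ((\<lambda>x. f (t, x)) has_vector_derivative f' (t, x)) (at x within {0..h})"
    for k and f f' :: "real \<times> real \<Rightarrow> 'a"
    by (rule dominated_integrate[where f = f, OF _ _ that(1) that(3) that(2)]) (auto simp: steps_def)
  note derivs = has_vector_derivative_diff increment_deriv has_vector_derivative_power_scaleR
    has_vector_derivative_ident_scaleR

  have w: "O_step 1 increment"
    by (rule dominatedI[of K]) (use norm_increment_le K_ge_1 in auto)
  have near: "norm (increment p) < R" if "p \<in> steps \<delta>" for p
  proof -
    have "K * snd p \<le> K * \<delta>" using that K_ge_1 by (auto simp: steps_def)
    then show ?thesis using norm_increment_le[OF that] \<delta>(2) by linarith
  qed
  have taylor: "dominated (steps \<delta>) (\<lambda>p. rem p - (1 / 2) *\<^sub>R B0 p (increment p) (increment p)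
      - (1 / 6) *\<^sub>R Q0 p (increment p) (increment p) (increment p)) (\<lambda>p. norm (increment p) ^ 4)"
    unfolding rem_def by (rule taylor_dominated[OF near])
  then have taylor4: "O_step 4 (\<lambda>p. rem p - (1 / 2) *\<^sub>R B0 p (increment p) (increment p)
      - (1 / 6) *\<^sub>R Q0 p (increment p) (increment p) (increment p))"
  proof (rule dominated_mono[where c = "K ^ 4"])
    fix p assume "p \<in> steps \<delta>"
    then show "norm (increment p) ^ 4 \<le> K ^ 4 * snd p ^ 4"
      using power_mono[OF norm_increment_le norm_ge_zero, of p \<delta> 4] by (simp add: power_mult_distrib)
  qed (use K_ge_1 in auto)
  have Bww: "O_step 2 (\<lambda>p. (1 / 2) *\<^sub>R B0 p (increment p) (increment p))"
    by (intro dominated_const_scaleR O_apply[OF O_apply[OF data(3) w order_refl] w]) simp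
  have Qwww: "O_step 2 (\<lambda>p. (1 / 6) *\<^sub>R Q0 p (increment p) (increment p) (increment p))"
    by (intro dominated_const_scaleR O_apply[OF O_apply[OF O_apply[OF data(4) w order_refl] w order_refl] w]) simp
  have rem2: "O_step 2 rem"
    by (rule dominated_cong[OF dominated_add[OF dominated_add[OF O_weaken[OF taylor4] Bww] Qwww]]) auto

  \<comment> \<open>Each pass inserts the current expansion into \<open>w' = f + J w + rem\<close> and integrates, which gains
    one order.\<close>
  define e2 where "e2 p = increment p - snd p *\<^sub>R f0 p" for p
  have e2: "O_step (Suc 1) e2"
  proof (rule integrate)
    show "O_step 1 (\<lambda>p. J0 p (increment p) + rem p)"
      by (intro dominated_add O_apply[OF J w] O_weaken[OF rem2]) simp_all
    fix t h x assume "(t, h) \<in> steps \<delta>" "x \<in> {0..h}"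
    then have "((\<lambda>x. e2 (t, x)) has_vector_derivative F (u (t + x)) - f0 (t, x)) (at x within {0..h})"
      unfolding e2_def fst_conv snd_conv by (intro derivs[unfolded fst_conv snd_conv])
    then show "((\<lambda>x. e2 (t, x)) has_vector_derivative J0 (t, x) (increment (t, x)) + rem (t, x))
        (at x within {0..h})"
      unfolding F_eq by simp
  qed (simp add: e2_def)

  define e3 where "e3 p = e2 p - (snd p ^ 2 / 2) *\<^sub>R J0 p (f0 p)" for p
  have e3: "O_step (Suc 2) e3"
  proof (rule integrate)
    show "O_step 2 (\<lambda>p. J0 p (e2 p) + rem p)"
      by (intro dominated_add O_apply[OF J e2] rem2) simp_all
    fix t h x assume "(t, h) \<in> steps \<delta>" "x \<in> {0..h}"
    then have "((\<lambda>x. e3 (t, x)) has_vector_derivative F (u (t + x)) - f0 (t, x)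
        - (real 2 * x ^ (2 - 1) / 2) *\<^sub>R J0 (t, x) (f0 (t, x))) (at x within {0..h})"
      unfolding e2_def e3_def fst_conv snd_conv by (intro derivs[unfolded fst_conv snd_conv])
    then show "((\<lambda>x. e3 (t, x)) has_vector_derivative J0 (t, x) (e2 (t, x)) + rem (t, x))
        (at x within {0..h})"
      unfolding F_eq by (simp add: e2_def blinfun.bilinear_simps algebra_simps)
  qed (simp add: e3_def e2_def)

  define rem4 where "rem4 p = rem p - snd p ^ 2 *\<^sub>R quad0 p - snd p ^ 3 *\<^sub>R cub0 p" for p
  have rem4: "O_step 4 rem4"
    unfolding rem4_def
    by (rule remainder_expansion[OF data _ taylor]) (use e3 in \<open>simp add: e3_def [abs_def] e2_def\<close>)
  have cub: "O_step 0 cub0" by (rule O_cubic_part[OF data])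

  define e4 where "e4 p = e3 p - (snd p ^ 3 / 6) *\<^sub>R J0 p (J0 p (f0 p)) - (snd p ^ 3 / 3) *\<^sub>R quad0 p" for p
  have e4: "O_step (Suc 3) e4"
  proof (rule integrate)
    show "O_step 3 (\<lambda>p. J0 p (e3 p) + rem4 p + snd p ^ 3 *\<^sub>R cub0 p)"
      by (intro dominated_add O_apply[OF J e3] O_weaken[OF rem4] O_scale[OF cub]) simp_all
    fix t h x assume "(t, h) \<in> steps \<delta>" "x \<in> {0..h}"
    then have "((\<lambda>x. e4 (t, x)) has_vector_derivative F (u (t + x)) - f0 (t, x)
        - (real 2 * x ^ (2 - 1) / 2) *\<^sub>R J0 (t, x) (f0 (t, x))
        - (real 3 * x ^ (3 - 1) / 6) *\<^sub>R J0 (t, x) (J0 (t, x) (f0 (t, x)))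
        - (real 3 * x ^ (3 - 1) / 3) *\<^sub>R quad0 (t, x)) (at x within {0..h})"
      unfolding e2_def e3_def e4_def fst_conv snd_conv by (intro derivs[unfolded fst_conv snd_conv])
    then show "((\<lambda>x. e4 (t, x)) has_vector_derivative
        J0 (t, x) (e3 (t, x)) + rem4 (t, x) + snd (t, x) ^ 3 *\<^sub>R cub0 (t, x)) (at x within {0..h})"
      unfolding F_eq by (simp add: e2_def e3_def rem4_def blinfun.bilinear_simps algebra_simps)
  qed (simp add: e4_def e3_def e2_def)

  define e5 where "e5 p = e4 p - (snd p ^ 4 / 24) *\<^sub>R J0 p (J0 p (J0 p (f0 p)))
      - (snd p ^ 4 / 12) *\<^sub>R J0 p (quad0 p) - (snd p ^ 4 / 4) *\<^sub>R cub0 p" for p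
  have e5: "O_step (Suc 4) e5"
  proof (rule integrate)
    show "O_step 4 (\<lambda>p. J0 p (e4 p) + rem4 p)"
      by (intro dominated_add O_apply[OF J e4] rem4) simp_all
    fix t h x assume "(t, h) \<in> steps \<delta>" "x \<in> {0..h}"
    then have "((\<lambda>x. e5 (t, x)) has_vector_derivative F (u (t + x)) - f0 (t, x)
        - (real 2 * x ^ (2 - 1) / 2) *\<^sub>R J0 (t, x) (f0 (t, x))
        - (real 3 * x ^ (3 - 1) / 6) *\<^sub>R J0 (t, x) (J0 (t, x) (f0 (t, x)))
        - (real 3 * x ^ (3 - 1) / 3) *\<^sub>R quad0 (t, x)
        - (real 4 * x ^ (4 - 1) / 24) *\<^sub>R J0 (t, x) (J0 (t, x) (J0 (t, x) (f0 (t, x))))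
        - (real 4 * x ^ (4 - 1) / 12) *\<^sub>R J0 (t, x) (quad0 (t, x))
        - (real 4 * x ^ (4 - 1) / 4) *\<^sub>R cub0 (t, x)) (at x within {0..h})"
      unfolding e2_def e3_def e4_def e5_def fst_conv snd_conv
      by (intro derivs[unfolded fst_conv snd_conv])
    then show "((\<lambda>x. e5 (t, x)) has_vector_derivative J0 (t, x) (e4 (t, x)) + rem4 (t, x))
        (at x within {0..h})"
      unfolding F_eq
      by (simp add: e2_def e3_def e4_def rem4_def blinfun.bilinear_simps algebra_simps)
  qed (simp add: e5_def e4_def e3_def e2_def)
  then show ?thesis by (simp add: e5_def [abs_def] e4_def e3_def e2_def)
qed

end

section \<open>Local error of the scheme\<close>

text \<open>The maximal step size \<open>\<delta>\<close> keeps \<open>h J\<close> well inside the disc of convergence of \<open>b\<^sub>2\<close> (half the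
  radius \<open>\<rho>\<close>, as the Lipschitz estimate for power series demands), and keeps the exact solution and
  the stage inside the balls of radius \<open>R\<close>. The numerical solution is allowed a distance of \<open>R / 2\<close>
  from the curve and the stage another \<open>R / 2\<close>.\<close>

locale rosenbrock_scheme = bounded_flow F u t0 T R K
  for F :: "'a::banach \<Rightarrow> 'a" and u t0 T R K +
  fixes \<beta> :: "nat \<Rightarrow> real" and \<rho> \<delta> :: real
  assumes \<rho>_pos: "0 < \<rho>" and \<beta>_summable: "summable (\<lambda>k. \<bar>\<beta> k\<bar> * \<rho> ^ k)"
    and \<beta>_0: "\<beta> 0 = 16 / 27" and \<beta>_1: "\<beta> 1 = 4 / 27"
    and \<delta>_pos: "0 < \<delta>" and \<delta>_le_1: "\<delta> \<le> 1"
    and \<delta>_radius: "K * \<delta> \<le> \<rho> / 2" and \<delta>_strip: "K * \<delta> < R"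
    and stage_near: "t \<in> {t0..T} \<Longrightarrow> v \<in> cball (u t) (R / 2) \<Longrightarrow> 0 \<le> h \<Longrightarrow> h \<le> \<delta> \<Longrightarrow>
      norm (exprb2_stage (3 / 4) F h v - v) < R / 2"
begin

definition stage_increment :: "real \<Rightarrow> 'a \<Rightarrow> 'a" where
  "stage_increment h v = (3 / 4 * h) *\<^sub>R phi 1 ((3 / 4 * h) *\<^sub>R fderiv F v) (F v)"

definition step_increment :: "real \<Rightarrow> 'a \<Rightarrow> 'a" where
  "step_increment h v = h *\<^sub>R phi 1 (h *\<^sub>R fderiv F v) (F v)
     + h *\<^sub>R op_series \<beta> (h *\<^sub>R fderiv F v) (taylor_remainder F v (stage_increment h v))"

lemma stage_eq: "exprb2_stage (3 / 4) F h v = v + stage_increment h v"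
  by (simp add: exprb2_stage_def stage_increment_def)

lemma step_eq: "exprb2_step (3 / 4) \<beta> F h v = v + step_increment h v"
  by (simp add: exprb2_step_def step_increment_def stage_eq rb_remainder_def taylor_remainder_def
      blinfun.bilinear_simps algebra_simps)

lemma step_deriv_le:
  assumes "t \<in> {t0..T}" "v \<in> ball (u t) R" "0 \<le> h" "h \<le> \<delta>"
  shows "norm (h *\<^sub>R fderiv F v) \<le> \<rho> / 2"
proof -
  have "h * norm (fderiv F v) \<le> \<delta> * K"
    using assms \<delta>_pos by (intro mult_mono fderiv_le[OF assms(1,2)]) auto
  then show ?thesis using assms \<delta>_radius by (simp add: mult.commute)
qed

text \<open>The coefficients of the two expansions agree:
  \<open>16/27 \<cdot> 9/16 = 1/3\<close>, \<open>16/27 \<cdot> 27/64 = 1/4\<close> and \<open>4/27 \<cdot> 9/16 = 1/12\<close>. The remaining product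
  \<open>4/27 \<cdot> 27/64 = 1/16\<close> multiplies a term of order five.\<close>

lemma local_error:
  "dominated (steps \<delta>) (\<lambda>p. step_increment (snd p) (u (fst p)) - increment p) (\<lambda>p. snd p ^ 5)"
proof -
  interpret small_steps "steps \<delta>" snd
    by unfold_locales (use \<delta>_le_1 in \<open>auto simp: steps_def\<close>)
  interpret stage: small_steps "steps \<delta>" "\<lambda>p. 3 / 4 * snd p"
    by unfold_locales (use \<delta>_le_1 in \<open>auto simp: steps_def\<close>)
  note data = data_bounded[of \<delta>]
  define W where "W p = stage_increment (snd p) (u (fst p))" for p
  define r where "r p = taylor_remainder F (u (fst p)) (W p)" for p

  have W_near: "norm (W p) < R" if "p \<in> steps \<delta>" for p
    using stage_near[of "fst p" "u (fst p)" "snd p"] that R_pos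
    by (auto simp: W_def stage_eq steps_def)
  \<comment> \<open>The stage is an increment with step size \<open>3/4 h\<close>.\<close>
  have "stage.O_step 4 (\<lambda>p. r p - (3 / 4 * snd p) ^ 2 *\<^sub>R quad0 p - (3 / 4 * snd p) ^ 3 *\<^sub>R cub0 p)"
  proof (rule stage.remainder_expansion)
    show "stage.O_step 0 f0" "stage.O_step 0 J0" "stage.O_step 0 B0" "stage.O_step 0 Q0"
      using data by simp_all
    then show "stage.O_step 3 (\<lambda>p. W p - (3 / 4 * snd p) *\<^sub>R f0 p - ((3 / 4 * snd p)\<^sup>2 / 2) *\<^sub>R J0 p (f0 p))"
      unfolding W_def stage_increment_def by (intro stage.phi_1_expansion_2)
    show "dominated (steps \<delta>) (\<lambda>p. r p - (1 / 2) *\<^sub>R B0 p (W p) (W p) - (1 / 6) *\<^sub>R Q0 p (W p) (W p) (W p))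
        (\<lambda>p. norm (W p) ^ 4)"
      unfolding r_def by (rule taylor_dominated[OF W_near])
  qed
  then have "O_step 4 (\<lambda>p. r p - (3 / 4 * snd p) ^ 2 *\<^sub>R quad0 p - (3 / 4 * snd p) ^ 3 *\<^sub>R cub0 p)"
    by (rule dominated_mono[where c = 1]) (auto simp: power_mult_distrib power_divide intro: power_mono)
  then have r_exp: "O_step 4 (\<lambda>p. r p - (9 / 16 * snd p ^ 2) *\<^sub>R quad0 p - (27 / 64 * snd p ^ 3) *\<^sub>R cub0 p)"
    by (rule dominated_cong) (simp add: power_mult_distrib power_divide)

  \<comment> \<open>\<open>G\<close>, \<open>E\<close>, \<open>S\<close> and \<open>X\<close> are the error terms in the expansions of the remainder at the stage, of
    \<open>b\<^sub>2\<close>, of the \<open>\<phi>\<^sub>1\<close> part of the step and of the exact increment.\<close>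
  define G where "G p = r p - (9 / 16 * snd p ^ 2) *\<^sub>R quad0 p - (27 / 64 * snd p ^ 3) *\<^sub>R cub0 p" for p
  have G: "O_step 4 G" unfolding G_def by (rule r_exp)
  have quad: "O_step 0 quad0" by (rule O_quadratic_part[OF data(3,1)])
  have cub: "O_step 0 cub0" by (rule O_cubic_part[OF data])
  have r2: "O_step 2 r"
  proof (rule dominated_cong)
    show "O_step 2 (\<lambda>p. G p + (9 / 16) *\<^sub>R (snd p ^ 2 *\<^sub>R quad0 p) + (27 / 64) *\<^sub>R (snd p ^ 3 *\<^sub>R cub0 p))"
      by (intro dominated_add dominated_const_scaleR O_scale[OF quad] O_scale[OF cub] O_weaken[OF G])
         simp_all
  qed (simp add: G_def)

  define E where "E p = op_series \<beta> (snd p *\<^sub>R J0 p) - (\<Sum>k<2. \<beta> k *\<^sub>R op_power (snd p *\<^sub>R J0 p) k)" for p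
  have E: "O_step 2 E"
    unfolding E_def
  proof (rule op_series_expansion[OF \<beta>_summable \<rho>_pos])
    fix p assume "p \<in> steps \<delta>"
    then have "norm (snd p *\<^sub>R J0 p) \<le> \<rho> / 2"
      by (intro step_deriv_le[OF steps_fst solution_in_ball]) (auto simp: steps_def)
    then show "norm (snd p *\<^sub>R J0 p) \<le> \<rho>" using \<rho>_pos by simp
  qed (rule O_scale1[OF data(2)], simp)
  have b2: "op_series \<beta> (snd p *\<^sub>R J0 p) (r p)
      = (16 / 27) *\<^sub>R r p + (4 / 27 * snd p) *\<^sub>R J0 p (r p) + E p (r p)" for p
    by (simp add: E_def eval_nat_numeral op_power_Suc blinfun.bilinear_simps \<beta>_0 \<beta>_1[unfolded One_nat_def])

  define S where "S p = snd p *\<^sub>R phi 1 (snd p *\<^sub>R J0 p) (f0 p) - snd p *\<^sub>R f0 p - (snd p ^ 2 / 2) *\<^sub>R J0 p (f0 p)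
      - (snd p ^ 3 / 6) *\<^sub>R J0 p (J0 p (f0 p)) - (snd p ^ 4 / 24) *\<^sub>R J0 p (J0 p (J0 p (f0 p)))" for p
  have S: "O_step 5 S"
    unfolding S_def by (rule phi_1_expansion_4[OF data(2,1)])
  define X where "X p = increment p - snd p *\<^sub>R f0 p - (snd p ^ 2 / 2) *\<^sub>R J0 p (f0 p)
      - (snd p ^ 3 / 6) *\<^sub>R J0 p (J0 p (f0 p)) - (snd p ^ 3 / 3) *\<^sub>R quad0 p
      - (snd p ^ 4 / 24) *\<^sub>R J0 p (J0 p (J0 p (f0 p))) - (snd p ^ 4 / 12) *\<^sub>R J0 p (quad0 p)
      - (snd p ^ 4 / 4) *\<^sub>R cub0 p" for p
  have X: "O_step 5 X"
    unfolding X_def by (rule exact_expansion[OF \<delta>_le_1 \<delta>_strip])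
  have "O_step 5 (\<lambda>p. S p + (16 / 27) *\<^sub>R (snd p *\<^sub>R G p) + (4 / 27) *\<^sub>R (snd p ^ 2 *\<^sub>R J0 p (G p))
      + (1 / 16) *\<^sub>R (snd p ^ 5 *\<^sub>R J0 p (cub0 p)) + snd p *\<^sub>R E p (r p) - X p)"
    by (intro dominated_add dominated_diff dominated_const_scaleR S X O_scale1[OF G]
        O_scale[OF O_apply[OF data(2) G order_refl]] O_scale[OF O_apply[OF data(2) cub order_refl]]
        O_scale1[OF O_apply[OF E r2 order_refl]]) simp_all
  then show ?thesis
  proof (rule dominated_cong)
    fix p
    have r_eq: "r p = G p + (9 / 16 * snd p ^ 2) *\<^sub>R quad0 p + (27 / 64 * snd p ^ 3) *\<^sub>R cub0 p"
      by (simp add: G_def)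
    have "snd p *\<^sub>R op_series \<beta> (snd p *\<^sub>R J0 p) (r p)
        = (16 / 27) *\<^sub>R (snd p *\<^sub>R G p) + (4 / 27) *\<^sub>R (snd p ^ 2 *\<^sub>R J0 p (G p))
          + (1 / 16) *\<^sub>R (snd p ^ 5 *\<^sub>R J0 p (cub0 p)) + snd p *\<^sub>R E p (r p)
          + (snd p ^ 3 / 3) *\<^sub>R quad0 p + (snd p ^ 4 / 12) *\<^sub>R J0 p (quad0 p) + (snd p ^ 4 / 4) *\<^sub>R cub0 p"
      unfolding b2
      by (subst (1 2) r_eq) (simp add: blinfun.bilinear_simps algebra_simps eval_nat_numeral)
    then show "step_increment (snd p) (u (fst p)) - increment p = S p + (16 / 27) *\<^sub>R (snd p *\<^sub>R G p)
        + (4 / 27) *\<^sub>R (snd p ^ 2 *\<^sub>R J0 p (G p)) + (1 / 16) *\<^sub>R (snd p ^ 5 *\<^sub>R J0 p (cub0 p))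
        + snd p *\<^sub>R E p (r p) - X p"
      unfolding step_increment_def S_def X_def by (fold W_def, fold r_def) (simp add: algebra_simps)
  qed
qed

end

section \<open>Stability and convergence\<close>

text \<open>The product rule for differences, \<open>A x - A' x' = (A - A') x + A' (x - x')\<close>.\<close>

lemma dominated_apply_diff:
  assumes "dominated P A' (\<lambda>p. 1)" "dominated P x (\<lambda>p. 1)"
    and "dominated P (\<lambda>p. A p - A' p) g" "dominated P (\<lambda>p. x p - x' p) g"
  shows "dominated P (\<lambda>p. blinfun_apply (A p) (x p) - A' p (x' p)) g"
proof -
  have "dominated P (\<lambda>p. blinfun_apply (A p - A' p) (x p)) g"
    using dominated_apply[OF assms(3,2)] by simp
  moreover have "dominated P (\<lambda>p. blinfun_apply (A' p) (x p - x' p)) g"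
    using dominated_apply[OF assms(1,4)] by simp
  ultimately show ?thesis
    by (rule dominated_cong[OF dominated_add]) (simp add: blinfun.bilinear_simps)
qed

lemma dominated_op_series_diff:
  fixes A A' :: "'p \<Rightarrow> 'a::banach \<Rightarrow>\<^sub>L 'a"
  assumes "summable (\<lambda>k. \<bar>\<gamma> k\<bar> * r ^ k)" "r > 0"
    and "\<And>p. p \<in> P \<Longrightarrow> norm (A p) \<le> r / 2" "\<And>p. p \<in> P \<Longrightarrow> norm (A' p) \<le> r / 2"
    and "dominated P (\<lambda>p. A p - A' p) g"
  shows "dominated P (\<lambda>p. op_series \<gamma> (A p) - op_series \<gamma> (A' p)) g"
proof -
  obtain C where C: "C \<ge> 0" "\<And>A B::'a \<Rightarrow>\<^sub>L 'a. norm A \<le> r / 2 \<Longrightarrow> norm B \<le> r / 2 \<Longrightarrow>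
      norm (op_series \<gamma> A - op_series \<gamma> B) \<le> C * norm (A - B)"
    using op_series_lipschitz[OF assms(1,2)] by blast
  obtain D where D: "0 \<le> D" "\<And>p. p \<in> P \<Longrightarrow> norm (A p - A' p) \<le> D * g p"
    using assms(5) by (rule dominatedE) blast
  show ?thesis
  proof (rule dominatedI[of "C * D"])
    fix p assume p: "p \<in> P"
    show "norm (op_series \<gamma> (A p) - op_series \<gamma> (A' p)) \<le> C * D * g p"
      using C(2)[OF assms(3)[OF p] assms(4)[OF p]] mult_left_mono[OF D(2)[OF p] C(1)]
      by (simp add: mult.assoc)
  qed (use C D in auto)
qed

lemma dominated_op_series:
  fixes A :: "'p \<Rightarrow> 'a::banach \<Rightarrow>\<^sub>L 'a"
  assumes "summable (\<lambda>k. \<bar>\<gamma> k\<bar> * r ^ k)" "r > 0" "\<And>p. p \<in> P \<Longrightarrow> norm (A p) \<le> r"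
  shows "dominated P (\<lambda>p. op_series \<gamma> (A p)) (\<lambda>p. 1)"
  using op_series_remainder[OF assms(1,2), where m = 0 and 'a = 'a] assms(3)
  unfolding dominated_def by auto

context rosenbrock_scheme
begin

text \<open>Every ingredient of the step, including the Jacobian at which the operator functions are
  evaluated, is a Lipschitz function of the starting point; sums and products of bounded Lipschitz
  functions are again Lipschitz, and the increment carries an overall factor \<open>h\<close>. In the proof,
  \<open>v\<close> is the perturbed point, \<open>y\<close> the point of the curve, and \<open>d\<close> their distance.\<close>

lemma step_increment_lipschitz:
  "\<exists>L\<ge>0. \<forall>t\<in>{t0..T}. \<forall>v\<in>cball (u t) (R / 2). \<forall>h\<in>{0..\<delta>}.
     norm (step_increment h v - step_increment h (u t)) \<le> L * (h * norm (v - u t))"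
proof -
  define P where "P = {0..\<delta>} \<times> (SIGMA t:{t0..T}. cball (u t) (R / 2))"
  define y where "y p = u (fst (snd p))" for p :: "real \<times> real \<times> 'a"
  define v where "v p = snd (snd p)" for p :: "real \<times> real \<times> 'a"
  define h where "h p = fst p" for p :: "real \<times> real \<times> 'a"
  define d where "d p = norm (v p - y p)" for p
  define W where "W z p = stage_increment (h p) (z p)" for z p
  define r where "r z p = taylor_remainder F (z p) (W z p)" for z p

  have h: "0 \<le> h p" "h p \<le> \<delta>" "h p \<le> 1" if "p \<in> P" for p
    using that \<delta>_le_1 by (auto simp: P_def h_def)
  have d: "0 \<le> d p" for p by (simp add: d_def)
  have near_W: "z p \<in> ball (y p) R" "norm (W z p) < R / 2" "z p + W z p \<in> ball (y p) R"
    if "p \<in> P" "z \<in> {v, y}" for p z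
  proof -
    have z: "z p \<in> cball (y p) (R / 2)" and t: "fst (snd p) \<in> {t0..T}"
      using that R_pos by (auto simp: P_def v_def y_def)
    then show "z p \<in> ball (y p) R" using R_pos by auto
    show W: "norm (W z p) < R / 2"
      using stage_near[OF t z[unfolded y_def] h(1,2)[OF that(1)]] by (simp add: stage_eq W_def)
    have "dist (y p) (z p + W z p) \<le> dist (y p) (z p) + norm (W z p)"
      by (metis add_diff_cancel_left' dist_commute dist_norm dist_triangle)
    then show "z p + W z p \<in> ball (y p) R" using W z by simp
  qed
  have t: "fst (snd p) \<in> {t0..T}" if "p \<in> P" for p using that by (auto simp: P_def)
  note F_le' = F_le[OF t, folded y_def] and fderiv_le' = fderiv_le[OF t, folded y_def]
    and F_lip' = F_lipschitz[OF t, folded y_def] and fderiv_lip' = fderiv_lipschitz[OF t, folded y_def]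

  have F1: "dominated P (\<lambda>p. F (z p)) (\<lambda>p. 1)" "dominated P (\<lambda>p. fderiv F (z p)) (\<lambda>p. 1)"
    "dominated P (\<lambda>p. F (z p + W z p)) (\<lambda>p. 1)" "dominated P (\<lambda>p. W z p) (\<lambda>p. 1)"
    if "z \<in> {v, y}" for z
  proof -
    show "dominated P (\<lambda>p. F (z p)) (\<lambda>p. 1)"
      by (rule dominatedI[of K]) (use K_ge_1 F_le' near_W that in auto)
    show "dominated P (\<lambda>p. fderiv F (z p)) (\<lambda>p. 1)"
      by (rule dominatedI[of K]) (use K_ge_1 fderiv_le' near_W that in auto)
    show "dominated P (\<lambda>p. F (z p + W z p)) (\<lambda>p. 1)"
      by (rule dominatedI[of K]) (use K_ge_1 F_le' near_W that in auto)
    show "dominated P (\<lambda>p. W z p) (\<lambda>p. 1)"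
      by (rule dominatedI[of "R / 2"]) (use R_pos near_W that in \<open>auto intro: less_imp_le\<close>)
  qed
  have F_diff: "dominated P (\<lambda>p. F (v p) - F (y p)) d"
  proof (rule dominatedI[of K])
    fix p assume p: "p \<in> P"
    show "norm (F (v p) - F (y p)) \<le> K * d p"
      unfolding d_def by (rule F_lip'[OF p near_W(1)[OF p] near_W(1)[OF p]]) auto
  qed (use K_ge_1 in auto)
  have J_diff: "dominated P (\<lambda>p. fderiv F (v p) - fderiv F (y p)) d"
  proof (rule dominatedI[of K])
    fix p assume p: "p \<in> P"
    show "norm (fderiv F (v p) - fderiv F (y p)) \<le> K * d p"
      unfolding d_def by (rule fderiv_lip'[OF p near_W(1)[OF p] near_W(1)[OF p]]) auto
  qed (use K_ge_1 in auto)

  have hJ_le: "norm ((c * h p) *\<^sub>R fderiv F (z p)) \<le> \<rho> / 2"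
    if "p \<in> P" "z \<in> {v, y}" "0 \<le> c" "c \<le> 1" for c p z
  proof -
    have "c * (h p * norm (fderiv F (z p))) \<le> 1 * (h p * norm (fderiv F (z p)))"
      using that h[OF that(1)] by (intro mult_right_mono) auto
    also have "\<dots> \<le> \<rho> / 2"
      using step_deriv_le[OF t[OF that(1)], folded y_def, OF near_W(1)[OF that(1,2)] h(1,2)[OF that(1)]]
        h[OF that(1)] by simp
    finally show ?thesis using that h[OF that(1)] by (simp add: abs_mult mult.assoc)
  qed
  have hJ_diff: "dominated P (\<lambda>p. (c * h p) *\<^sub>R fderiv F (v p) - (c * h p) *\<^sub>R fderiv F (y p)) d"
    if "0 \<le> c" for c
  proof -
    have "dominated P (\<lambda>p. h p *\<^sub>R (fderiv F (v p) - fderiv F (y p))) (\<lambda>p. h p * d p)"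
      by (intro dominated_scaleR dominated_self J_diff h)
    then have "dominated P (\<lambda>p. h p *\<^sub>R (fderiv F (v p) - fderiv F (y p))) d"
      by (rule dominated_mono[where c = 1]) (use h d in \<open>auto intro: mult_left_le_one_le\<close>)
    from dominated_const_scaleR[OF this, of c] show ?thesis
      by (rule dominated_cong) (simp add: scaleR_diff_right)
  qed
  have series: "dominated P (\<lambda>p. op_series \<gamma> ((c * h p) *\<^sub>R fderiv F (v p))
        - op_series \<gamma> ((c * h p) *\<^sub>R fderiv F (y p))) d"
    "dominated P (\<lambda>p. op_series \<gamma> ((c * h p) *\<^sub>R fderiv F (y p))) (\<lambda>p. 1)"
    if "0 \<le> c" "c \<le> 1" "summable (\<lambda>k. \<bar>\<gamma> k\<bar> * \<rho> ^ k)" for c \<gamma>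
  proof -
    show "dominated P (\<lambda>p. op_series \<gamma> ((c * h p) *\<^sub>R fderiv F (v p))
        - op_series \<gamma> ((c * h p) *\<^sub>R fderiv F (y p))) d"
      by (rule dominated_op_series_diff[OF that(3) \<rho>_pos _ _ hJ_diff[OF that(1)]])
         (rule hJ_le[OF _ _ that(1,2)]; simp)+
    show "dominated P (\<lambda>p. op_series \<gamma> ((c * h p) *\<^sub>R fderiv F (y p))) (\<lambda>p. 1)"
    proof (rule dominated_op_series[OF that(3) \<rho>_pos])
      fix p assume "p \<in> P"
      from hJ_le[OF this, of y c] that show "norm ((c * h p) *\<^sub>R fderiv F (y p)) \<le> \<rho>"
        using \<rho>_pos by auto
    qed
  qed
  have phi: "dominated P (\<lambda>p. phi 1 ((c * h p) *\<^sub>R fderiv F (v p)) (F (v p))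
      - phi 1 ((c * h p) *\<^sub>R fderiv F (y p)) (F (y p))) d" if "0 \<le> c" "c \<le> 1" for c
    unfolding phi_1_eq_op_series
    by (intro dominated_apply_diff series that F1 F_diff summable_phi1_coeff) (use \<rho>_pos in auto)

  have W_diff: "dominated P (\<lambda>p. W v p - W y p) d"
  proof -
    have "dominated P (\<lambda>p. h p *\<^sub>R (phi 1 ((3 / 4 * h p) *\<^sub>R fderiv F (v p)) (F (v p))
        - phi 1 ((3 / 4 * h p) *\<^sub>R fderiv F (y p)) (F (y p)))) (\<lambda>p. h p * d p)"
      by (intro dominated_scaleR dominated_self phi h) auto
    then have "dominated P (\<lambda>p. h p *\<^sub>R (phi 1 ((3 / 4 * h p) *\<^sub>R fderiv F (v p)) (F (v p))
        - phi 1 ((3 / 4 * h p) *\<^sub>R fderiv F (y p)) (F (y p)))) d"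
      by (rule dominated_mono[where c = 1]) (use h d in \<open>auto intro: mult_left_le_one_le\<close>)
    from dominated_const_scaleR[OF this, of "3 / 4"] show ?thesis
      by (rule dominated_cong) (simp add: W_def stage_increment_def scaleR_diff_right)
  qed
  have FW_diff: "dominated P (\<lambda>p. F (v p + W v p) - F (y p + W y p)) d"
  proof -
    have "dominated P (\<lambda>p. v p - y p) d" by (rule dominatedI[of 1]) (auto simp: d_def)
    from dominated_add[OF this W_diff]
    obtain C where C: "0 \<le> C" "\<And>p. p \<in> P \<Longrightarrow> norm ((v p - y p) + (W v p - W y p)) \<le> C * d p"
      by (rule dominatedE) blast
    show ?thesis
    proof (rule dominatedI[of "K * C"])
      fix p assume p: "p \<in> P"
      have "norm (F (v p + W v p) - F (y p + W y p)) \<le> K * norm ((v p + W v p) - (y p + W y p))"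
        by (rule F_lip'[OF p near_W(3)[OF p] near_W(3)[OF p]]) auto
      also have "\<dots> \<le> K * (C * d p)"
        using C(2)[OF p] K_ge_1 by (intro mult_left_mono) (auto simp: algebra_simps)
      finally show "norm (F (v p + W v p) - F (y p + W y p)) \<le> K * C * d p" by simp
    qed (use K_ge_1 C in auto)
  qed
  have r_diff: "dominated P (\<lambda>p. r v p - r y p) d"
    by (rule dominated_cong[OF dominated_diff[OF dominated_diff[OF FW_diff F_diff]
            dominated_apply_diff[OF F1(2) F1(4) J_diff W_diff]]])
       (auto simp: r_def taylor_remainder_def algebra_simps)
  have r1: "dominated P (\<lambda>p. r v p) (\<lambda>p. 1)"
  proof -
    have "dominated P (\<lambda>p. fderiv F (v p) (W v p)) (\<lambda>p. 1)"
      using dominated_apply[OF F1(2) F1(4), of v v] by simp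
    then show ?thesis
      unfolding r_def taylor_remainder_def by (intro dominated_diff F1) auto
  qed
  have b2: "dominated P (\<lambda>p. op_series \<beta> (h p *\<^sub>R fderiv F (v p)) (r v p)
      - op_series \<beta> (h p *\<^sub>R fderiv F (y p)) (r y p)) d"
    using series[of 1 \<beta>] \<beta>_summable by (intro dominated_apply_diff r1 r_diff) auto
  have phi_1: "dominated P (\<lambda>p. phi 1 (h p *\<^sub>R fderiv F (v p)) (F (v p))
      - phi 1 (h p *\<^sub>R fderiv F (y p)) (F (y p))) d"
    using phi[of 1] by simp
  have "dominated P (\<lambda>p. h p *\<^sub>R ((phi 1 (h p *\<^sub>R fderiv F (v p)) (F (v p))
      - phi 1 (h p *\<^sub>R fderiv F (y p)) (F (y p)))
      + (op_series \<beta> (h p *\<^sub>R fderiv F (v p)) (r v p)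
         - op_series \<beta> (h p *\<^sub>R fderiv F (y p)) (r y p)))) (\<lambda>p. h p * d p)"
    by (intro dominated_scaleR dominated_self dominated_add phi_1 b2 h)
  then have "dominated P (\<lambda>p. step_increment (h p) (v p) - step_increment (h p) (y p)) (\<lambda>p. h p * d p)"
    by (rule dominated_cong) (simp add: step_increment_def r_def W_def algebra_simps)
  then show ?thesis
    unfolding dominated_def P_def
    by (elim exE conjE, intro exI conjI ballI) (auto simp: h_def v_def y_def d_def)
qed

text \<open>The error satisfies \<open>e\<^sub>m\<^sub>+\<^sub>1 \<le> (1 + L h) e\<^sub>m + C h\<^sup>5\<close>, hence \<open>e\<^sub>m \<le> m C h\<^sup>5 (1 + L h)\<^sup>m\<close>, and
  \<open>m h \<le> T - t\<^sub>0\<close> turns this into \<open>M h\<^sup>4\<close>. The recursion is valid only as long as the numerical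
  solution is within \<open>R / 2\<close> of the curve; the bound itself guarantees this for the next step,
  provided that \<open>M h\<^sub>0 \<le> R / 2\<close>.\<close>

lemma global_error:
  assumes "t0 \<le> T"
  shows "\<exists>C h0. h0 > 0 \<and> (\<forall>h n. 0 < h \<and> h \<le> h0 \<and> t0 + real n * h \<le> T \<longrightarrow>
      norm (exprb2 (3 / 4) \<beta> F h (u t0) n - u (t0 + real n * h)) \<le> C * h ^ 4)"
proof -
  obtain L where L: "L \<ge> 0" "\<And>t v h. t \<in> {t0..T} \<Longrightarrow> v \<in> cball (u t) (R / 2) \<Longrightarrow> h \<in> {0..\<delta>} \<Longrightarrow>
      norm (step_increment h v - step_increment h (u t)) \<le> L * (h * norm (v - u t))"
    using step_increment_lipschitz by blast
  obtain C where C: "C \<ge> 0" "\<And>p. p \<in> steps \<delta> \<Longrightarrow>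
      norm (step_increment (snd p) (u (fst p)) - increment p) \<le> C * snd p ^ 5"
    using local_error by (rule dominatedE) blast
  define M where "M = (T - t0) * C * exp (L * (T - t0))"
  have M: "M \<ge> 0" unfolding M_def using assms C by simp
  \<comment> \<open>The \<open>1\<close> keeps the denominator positive when \<open>M\<close> vanishes.\<close>
  define h0 where "h0 = min \<delta> (R / (2 * (M + 1)))"
  have h0: "0 < h0" "h0 \<le> \<delta>" "h0 \<le> 1"
    using \<delta>_pos \<delta>_le_1 R_pos M by (auto simp: h0_def)
  have Mh0: "M * h0 \<le> R / 2"
  proof -
    have "h0 * (2 * (M + 1)) \<le> R"
      using M by (subst pos_le_divide_eq[symmetric]) (auto simp: h0_def)
    then show ?thesis using h0(1) by (simp add: algebra_simps)
  qed
  have bound: "norm (exprb2 (3 / 4) \<beta> F h (u t0) n - u (t0 + real n * h)) \<le> M * h ^ 4"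
    if h: "0 < h" "h \<le> h0" and n: "t0 + real n * h \<le> T" for h n
  proof -
    define e where "e m = norm (exprb2 (3 / 4) \<beta> F h (u t0) m - u (t0 + real m * h))" for m
    have M_bound: "real m * C * h ^ 5 * (1 + L * h) ^ m \<le> M * h ^ 4" if "m \<le> n" for m
    proof -
      have mh: "real m * h \<le> T - t0"
      proof -
        have "real m * h \<le> real n * h" using that h by (intro mult_right_mono) auto
        then show ?thesis using n by linarith
      qed
      have "(1 + L * h) ^ m \<le> exp (L * h) ^ m"
        using L h by (intro power_mono exp_ge_add_one_self) auto
      also have "\<dots> = exp (L * (real m * h))" by (simp add: exp_of_nat_mult[symmetric] mult_ac)
      also have "\<dots> \<le> exp (L * (T - t0))" using mh L by (simp add: mult_left_mono)
      finally have "(real m * h) * (C * (1 + L * h) ^ m) \<le> (T - t0) * (C * exp (L * (T - t0)))"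
        using mh C h L assms by (intro mult_mono) auto
      from mult_right_mono[OF this, of "h ^ 4"] h show ?thesis
        by (simp add: M_def eval_nat_numeral mult_ac)
    qed
    have "e m \<le> real m * C * h ^ 5 * (1 + L * h) ^ m" if "m \<le> n" for m
      using that
    proof (induction m)
      case 0
      then show ?case by (simp add: e_def)
    next
      case (Suc m)
      define t where "t = t0 + real m * h"
      define x where "x = exprb2 (3 / 4) \<beta> F h (u t0) m"
      have "real (Suc m) * h \<le> real n * h" using Suc.prems h by (intro mult_right_mono) auto
      then have th: "(t, h) \<in> steps \<delta>" "t \<in> {t0..T}"
        using n h h0 by (auto simp: t_def steps_def algebra_simps)
      have em: "e m \<le> real m * C * h ^ 5 * (1 + L * h) ^ m" using Suc by simp
      have "h ^ 4 \<le> h0" using h h0 power_decreasing[of 1 4 h] by simp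
      then have "M * h ^ 4 \<le> R / 2" using Mh0 mult_left_mono[OF _ M] by fastforce
      then have "e m \<le> R / 2" using em M_bound[of m] Suc.prems by simp
      then have x: "x \<in> cball (u t) (R / 2)" by (simp add: e_def x_def t_def dist_norm norm_minus_commute)
      have next_t: "t0 + real (Suc m) * h = t + h" by (simp add: t_def algebra_simps)
      have "e (Suc m) = norm ((x - u t) + (step_increment h x - step_increment h (u t))
          + (step_increment h (u t) - (u (t + h) - u t)))"
        unfolding e_def next_t by (simp add: step_eq x_def algebra_simps)
      also have "\<dots> \<le> norm (x - u t) + L * (h * norm (x - u t)) + C * h ^ 5"
        using L(2)[OF th(2) x] C(2)[OF th(1)] h h0
        by (intro norm_triangle_le add_mono norm_triangle_mono order_refl) auto
      also have "\<dots> = (1 + L * h) * e m + C * h ^ 5" by (simp add: e_def x_def t_def algebra_simps)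
      also have "\<dots> \<le> (1 + L * h) * (real m * C * h ^ 5 * (1 + L * h) ^ m)
          + C * h ^ 5 * (1 + L * h) ^ Suc m"
      proof (rule add_mono)
        show "(1 + L * h) * e m \<le> (1 + L * h) * (real m * C * h ^ 5 * (1 + L * h) ^ m)"
          using em L(1) h by (intro mult_left_mono) auto
        have "1 \<le> (1 + L * h) ^ Suc m" using L(1) h by (intro one_le_power) auto
        from mult_left_mono[OF this, of "C * h ^ 5"] show "C * h ^ 5 \<le> C * h ^ 5 * (1 + L * h) ^ Suc m"
          using C(1) h by simp
      qed
      also have "\<dots> = real (Suc m) * C * h ^ 5 * (1 + L * h) ^ Suc m" by (simp add: algebra_simps)
      finally show ?case .
    qed
    from this[of n] M_bound[of n] show ?thesis by (simp add: e_def)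
  qed
  then show ?thesis using h0(1) by blast
qed

end

theorem theorem3p1:
  fixes F :: "'a::banach \<Rightarrow> 'a"
    and u :: "real \<Rightarrow> 'a"
    and u0 :: 'a
    and t0 T R :: real
    and \<beta> :: "nat \<Rightarrow> real"
  assumes "t0 < T"
    and "\<forall>t\<in>{t0..T}. (u has_vector_derivative F (u t)) (at t within {t0..T})"
    and "u t0 = u0"
    and "curve_differentiable_bounded_on 5 u {t0..T}"
    and "R > 0"
    and "four_times_differentiable_bounded_on F (strip u {t0..T} R)"
    and "conv_radius \<beta> > 0"
    and "\<beta> 0 = 16 / 27"
    and "\<beta> 1 = 4 / 27"
  shows "\<exists>C h0. h0 > 0 \<and>
           (\<forall>h n. 0 < h \<and> h \<le> h0 \<and> t0 + real n * h \<le> T \<longrightarrow>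
              norm (exprb2 (3 / 4) \<beta> F h u0 n - u (t0 + real n * h)) \<le> C * h ^ 4)"
proof -
  let ?S = "strip u {t0..T} R"
  have ball: "ball (u t) R \<subseteq> ?S" if "t \<in> {t0..T}" for t
    using that by (auto simp: strip_def dist_norm norm_minus_commute)
  have "u ` {t0..T} \<subseteq> ?S" using ball assms(5) by fastforce
  have diff: "differentiable_bounded_on F ?S" "differentiable_bounded_on (fderiv F) ?S"
    "differentiable_bounded_on (fderiv2 F) ?S"
    using assms(6) by (auto simp: four_times_differentiable_bounded_on_def)
  obtain K1 where K1: "\<And>v. v \<in> ?S \<Longrightarrow> norm (fderiv F v) \<le> K1"
    using diff(1) by (auto simp: differentiable_bounded_on_def bounded_iff)
  obtain K2 where K2: "\<And>v. v \<in> ?S \<Longrightarrow> norm (fderiv2 F v) \<le> K2"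
    using diff(2) by (auto simp: differentiable_bounded_on_def bounded_iff)
  obtain K3 where K3: "\<And>v. v \<in> ?S \<Longrightarrow> norm (fderiv3 F v) \<le> K3"
    using diff(3) by (auto simp: differentiable_bounded_on_def bounded_iff)
  note K = K1 K2 K3
  obtain L0 where L0: "L0 \<ge> 0" "\<And>D x y. convex D \<Longrightarrow> D \<subseteq> ?S \<Longrightarrow> x \<in> D \<Longrightarrow> y \<in> D \<Longrightarrow>
      norm (F x - F y) \<le> L0 * norm (x - y)"
    using lipschitz_on_convex_subsets[OF diff(1)] by blast
  obtain L1 where L1: "L1 \<ge> 0" "\<And>D x y. convex D \<Longrightarrow> D \<subseteq> ?S \<Longrightarrow> x \<in> D \<Longrightarrow> y \<in> D \<Longrightarrow>
      norm (fderiv F x - fderiv F y) \<le> L1 * norm (x - y)"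
    using lipschitz_on_convex_subsets[OF diff(2)] by blast
  obtain L3 where L3: "L3 \<ge> 0" "\<And>y r w. ball y r \<subseteq> ?S \<Longrightarrow> norm w < r \<Longrightarrow>
      norm (F (y + w) - F y - fderiv F y w - (1 / 2) *\<^sub>R fderiv2 F y w w
        - (1 / 6) *\<^sub>R fderiv3 F y w w w) \<le> L3 * norm w ^ 4"
    using taylor_third_order[OF assms(6)] by blast
  have "continuous_on {t0..T} u"
    using assms(2) by (auto simp: continuous_on_eq_continuous_within intro: has_vector_derivative_continuous)
  moreover have "continuous_on ?S F"
    using diff(1) unfolding differentiable_bounded_on_def
    by (auto intro!: continuous_at_imp_continuous_on differentiable_imp_continuous_within)
  ultimately have "compact ((F \<circ> u) ` {t0..T})"
    using \<open>u ` {t0..T} \<subseteq> ?S\<close>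
    by (intro compact_continuous_image continuous_on_compose) (auto intro: continuous_on_subset)
  then obtain K0 where "\<forall>x\<in>(F \<circ> u) ` {t0..T}. norm x \<le> K0"
    by (blast dest: compact_imp_bounded bounded_iff[THEN iffD1])
  then have K0: "norm (F (u t)) \<le> K0" if "t \<in> {t0..T}" for t using that by auto

  \<comment> \<open>\<open>K0\<close> bounds \<open>F\<close> on the curve only; the Lipschitz constant carries the bound over to the balls.\<close>
  define K where "K = Max {1, K0 + L0 * R, K1, K2, K3, L0, L1, L3}"
  have K_ge: "1 \<le> K" "K0 + L0 * R \<le> K" "K1 \<le> K" "K2 \<le> K" "K3 \<le> K" "L0 \<le> K" "L1 \<le> K" "L3 \<le> K"
    unfolding K_def by (rule Max_ge; simp)+
  interpret bounded_flow F u t0 T R K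
  proof
    fix t and v w :: 'a assume t: "t \<in> {t0..T}"
    note S = subsetD[OF ball[OF t]]
    have u_t: "u t \<in> ball (u t) R" using assms(5) by simp
    show "(u has_vector_derivative F (u t)) (at t within {t0..T})" using assms(2) t by blast
    show "norm (fderiv2 F (u t)) \<le> K" "norm (fderiv3 F (u t)) \<le> K"
      using K(2,3)[OF S[OF u_t]] K_ge by auto
    {
      assume v: "v \<in> ball (u t) R"
      have "norm (F v - F (u t)) \<le> L0 * norm (v - u t)"
        by (rule L0(2)[OF convex_ball ball[OF t] v u_t])
      also have "\<dots> \<le> L0 * R"
        using v L0(1) by (intro mult_left_mono) (auto simp: dist_norm norm_minus_commute)
      finally show "norm (F v) \<le> K"
        using K0[OF t] K_ge(2) norm_triangle_sub[of "F v" "F (u t)"] by linarith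
      show "norm (fderiv F v) \<le> K" using K(1)[OF S[OF v]] K_ge by simp
      assume w: "w \<in> ball (u t) R"
      show "norm (F v - F w) \<le> K * norm (v - w)"
        using L0(2)[OF convex_ball ball[OF t] v w] mult_right_mono[OF K_ge(6) norm_ge_zero] order_trans
        by blast
      show "norm (fderiv F v - fderiv F w) \<le> K * norm (v - w)"
        using L1(2)[OF convex_ball ball[OF t] v w] mult_right_mono[OF K_ge(7) norm_ge_zero] order_trans
        by blast
    }
    assume w: "norm w < R"
    show "norm (taylor_remainder F (u t) w - (1 / 2) *\<^sub>R fderiv2 F (u t) w w
        - (1 / 6) *\<^sub>R fderiv3 F (u t) w w w) \<le> K * norm w ^ 4"
      unfolding taylor_remainder_def
      using L3(2)[OF ball[OF t] w] mult_right_mono[OF K_ge(8), of "norm w ^ 4"] by simp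
  qed (use assms K_ge in auto)

  obtain \<rho> where \<rho>: "0 < \<rho>" "ereal \<rho> < conv_radius \<beta>"
    using ereal_dense2[OF assms(7)] by (auto simp: zero_ereal_def)
  have \<beta>_summable: "summable (\<lambda>k. \<bar>\<beta> k\<bar> * \<rho> ^ k)"
    using abs_summable_in_conv_radius[of \<rho> \<beta>] \<rho> by (simp add: abs_mult power_abs)
  obtain C where C: "C \<ge> 0" "\<And>A::'a \<Rightarrow>\<^sub>L 'a. norm A \<le> K \<Longrightarrow> norm (phi 1 A) \<le> C"
    using op_series_remainder[OF summable_phi1_coeff, of K 0] K_ge(1)
    unfolding phi_1_eq_op_series by auto
  \<comment> \<open>The stage increment has norm at most \<open>\<delta> C K\<close>, so the last term gives \<open>R / 2\<close> for it and at the
    same time \<open>K \<delta> < R\<close> for the exact solution.\<close>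
  define \<delta> where "\<delta> = min (min 1 (\<rho> / (2 * K))) (R / (2 * K * (C + 1)))"
  have \<delta>: "0 < \<delta>" "\<delta> \<le> 1" "\<delta> \<le> \<rho> / (2 * K)" "\<delta> \<le> R / (2 * K * (C + 1))"
    using \<rho> K_ge(1) assms(5) C(1) by (auto simp: \<delta>_def)
  have \<delta>_R: "(K * (C + 1)) * \<delta> \<le> R / 2"
  proof -
    have "0 < 2 * K * (C + 1)" using K_ge(1) C(1) by simp
    then have "\<delta> * (2 * K * (C + 1)) \<le> R" using \<delta>(4) by (simp only: pos_le_divide_eq)
    then show ?thesis by (simp add: algebra_simps)
  qed
  interpret rosenbrock_scheme F u t0 T R K \<beta> \<rho> \<delta>
  proof
    show "K * \<delta> \<le> \<rho> / 2" using \<delta>(3) K_ge(1) by (simp add: field_simps)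
    have "K * \<delta> \<le> (K * (C + 1)) * \<delta>" using K_ge(1) C(1) \<delta>(1) by (intro mult_right_mono) auto
    then show "K * \<delta> < R" using \<delta>_R assms(5) by linarith
    fix t and v :: 'a and h :: real
    assume t: "t \<in> {t0..T}" and v: "v \<in> cball (u t) (R / 2)" and h: "0 \<le> h" "h \<le> \<delta>"
    have v': "v \<in> ball (u t) R" using v assms(5) by auto
    have "(3 / 4 * h) * norm (fderiv F v) \<le> 1 * K"
      using h \<delta>(2) K_ge(1) by (intro mult_mono fderiv_le[OF t v']) auto
    then have "norm (phi 1 ((3 / 4 * h) *\<^sub>R fderiv F v)) \<le> C" using h by (intro C(2)) simp
    then have "norm (phi 1 ((3 / 4 * h) *\<^sub>R fderiv F v) (F v)) \<le> C * K"
      using F_le[OF t v'] C(1) by (intro order_trans[OF norm_blinfun] mult_mono) auto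
    then have "(3 / 4 * h) * norm (phi 1 ((3 / 4 * h) *\<^sub>R fderiv F v) (F v)) \<le> \<delta> * (C * K)"
      using h C(1) K_ge(1) by (intro mult_mono) auto
    also have "\<dots> < \<delta> * ((C + 1) * K)" using \<delta>(1) K_ge(1) by (intro mult_strict_left_mono) auto
    also have "\<dots> \<le> R / 2" using \<delta>_R by (simp add: mult_ac)
    finally show "norm (exprb2_stage (3 / 4) F h v - v) < R / 2"
      using h by (simp add: exprb2_stage_def)
  qed (use \<rho> \<beta>_summable assms \<delta> in auto)
  show ?thesis using global_error assms(1,3) by simp
qed

end
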